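(* Let $n\ge2$, $\mathbb{R}_+=[0,+\infty)$, and let $p_1\equiv C_0$ be a complex constant and $p_j\in L_{1,loc}(\mathbb{R}_+)$, $j=2,\ldots,n$, complex-valued functions. Let $$l(y)=y^{(n)}+\sum_{j=1}^n p_j\,y^{(n-j)},$$ $$\mathscr{D}_0=\{y\in L_2(\mathbb{R}_+):\ y,y',\ldots,y^{(n-1)}\in AC_{loc}(\mathbb{R}_+),\ l(y)\in L_2(\mathbb{R}_+),\ y(0)=\ldots=y^{(n-1)}(0)=0,\ \exists x_0>0\ \forall x\ge x_0\ y(x)=0\},$$ and let $L_0$ be the operator in $L_2(\mathbb{R}_+)$ with domain $\mathscr{D}_0$ acting by $L_0y=l(y)$. If $L_0$ has an extension with compact resolvent, then for every infinite system of pairwise disjoint intervals $D_k\subset\mathbb{R}_+$ of equal length, $$\int_{D_k}\sum_{j=2}^n|p_j(x)|\,dx\to+\infty\quad\text{as } k\to\infty.$$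
   Context: $AC_{loc}(\mathbb{R}_+)$ denotes functions absolutely continuous on every compact subinterval of $[0,+\infty)$. An extension of $L_0$ is an operator $L\supset L_0$ in $L_2(\mathbb{R}_+)$; it has compact resolvent if its resolvent set is nonempty and its resolvent is a compact operator. *)

theory Defs
  imports "HOL-Analysis.Analysis"
begin

definition abs_cont_on_interval :: "real \<Rightarrow> real \<Rightarrow> (real \<Rightarrow> 'a::real_normed_vector) \<Rightarrow> bool" where
  "abs_cont_on_interval a b f \<longleftrightarrow>
     (\<forall>\<epsilon>>0. \<exists>\<delta>>0. \<forall>(m::nat) (u::nat \<Rightarrow> real) (v::nat \<Rightarrow> real).
        (\<forall>i<m. a \<le> u i \<and> u i \<le> v i \<and> v i \<le> b) \<and>
        (\<forall>i<m. \<forall>j<m. i \<noteq> j \<longrightarrow> v i \<le> u j \<or> v j \<le> u i) \<and>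
        (\<Sum>i<m. v i - u i) < \<delta>
        \<longrightarrow> (\<Sum>i<m. norm (f (v i) - f (u i))) < \<epsilon>)"

definition AC_loc :: "(real \<Rightarrow> 'a::real_normed_vector) \<Rightarrow> bool" where
  "AC_loc f \<longleftrightarrow> (\<forall>a b. 0 \<le> a \<longrightarrow> a \<le> b \<longrightarrow> abs_cont_on_interval a b f)"

abbreviation Rplus :: "real measure" where
  "Rplus \<equiv> lebesgue_on {0..}"

definition L2 :: "(real \<Rightarrow> complex) \<Rightarrow> bool" where
  "L2 f \<longleftrightarrow> f \<in> borel_measurable Rplus \<and> integrable Rplus (\<lambda>x. (cmod (f x))\<^sup>2)"

definition L2_norm :: "(real \<Rightarrow> complex) \<Rightarrow> real" where
  "L2_norm f = sqrt (\<integral>x. (cmod (f x))\<^sup>2 \<partial>Rplus)"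

definition ae_eq :: "(real \<Rightarrow> complex) \<Rightarrow> (real \<Rightarrow> complex) \<Rightarrow> bool" where
  "ae_eq f g \<longleftrightarrow> (AE x in Rplus. f x = g x)"

definition L1_loc :: "(real \<Rightarrow> complex) \<Rightarrow> bool" where
  "L1_loc p \<longleftrightarrow> (\<forall>b\<ge>0. integrable (lebesgue_on {0..b}) p)"

text \<open>A (linear) operator in L_2(R+) is represented by its graph G, a set of pairs of
  L_2 functions which is a linear subspace, compatible with a.e. equality, and single-valued
  modulo a.e. equality.\<close>
definition is_operator :: "((real \<Rightarrow> complex) \<times> (real \<Rightarrow> complex)) set \<Rightarrow> bool" where
  "is_operator G \<longleftrightarrow>
     (\<forall>(y,f)\<in>G. L2 y \<and> L2 f) \<and>
     (\<lambda>_. 0, \<lambda>_. 0) \<in> G \<and>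
     (\<forall>(y,f)\<in>G. \<forall>(z,g)\<in>G. \<forall>c::complex.
         (\<lambda>x. y x + c * z x, \<lambda>x. f x + c * g x) \<in> G) \<and>
     (\<forall>(y,f)\<in>G. \<forall>y' f'. L2 y' \<longrightarrow> L2 f' \<longrightarrow> ae_eq y y' \<longrightarrow> ae_eq f f' \<longrightarrow> (y',f') \<in> G) \<and>
     (\<forall>(y,f)\<in>G. \<forall>(z,g)\<in>G. ae_eq y z \<longrightarrow> ae_eq f g)"

definition in_resolvent_set :: "((real \<Rightarrow> complex) \<times> (real \<Rightarrow> complex)) set \<Rightarrow> complex \<Rightarrow> bool" where
  "in_resolvent_set G \<mu> \<longleftrightarrow>
     (\<forall>y. (y, \<lambda>x. \<mu> * y x) \<in> G \<longrightarrow> ae_eq y (\<lambda>_. 0)) \<and>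
     (\<forall>g. L2 g \<longrightarrow> (\<exists>y. (y, \<lambda>x. g x + \<mu> * y x) \<in> G)) \<and>
     (\<exists>C. \<forall>y g. (y, \<lambda>x. g x + \<mu> * y x) \<in> G \<longrightarrow> L2_norm y \<le> C * L2_norm g)"

definition compact_resolvent_at :: "((real \<Rightarrow> complex) \<times> (real \<Rightarrow> complex)) set \<Rightarrow> complex \<Rightarrow> bool" where
  "compact_resolvent_at G \<mu> \<longleftrightarrow>
     (\<forall>(g::nat \<Rightarrow> real \<Rightarrow> complex) (y::nat \<Rightarrow> real \<Rightarrow> complex) B.
        (\<forall>k. L2 (g k) \<and> L2_norm (g k) \<le> B \<and> (y k, \<lambda>x. g k x + \<mu> * y k x) \<in> G) \<longrightarrow>
        (\<exists>r z. strict_mono r \<and> L2 z \<and>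
               (\<lambda>k. L2_norm (\<lambda>x. y (r k) x - z x)) \<longlonglongrightarrow> 0))"

definition has_compact_resolvent :: "((real \<Rightarrow> complex) \<times> (real \<Rightarrow> complex)) set \<Rightarrow> bool" where
  "has_compact_resolvent G \<longleftrightarrow> (\<exists>\<mu>. in_resolvent_set G \<mu> \<and> compact_resolvent_at G \<mu>)"

text \<open>The differential expression l(y) = y^(n) + sum_{j=1}^n p_j y^(n-j), where Y k stands for
  the k-th derivative y^(k) of y (Y 0 = y).\<close>
definition diff_expr :: "nat \<Rightarrow> (nat \<Rightarrow> real \<Rightarrow> complex) \<Rightarrow> (nat \<Rightarrow> real \<Rightarrow> complex) \<Rightarrow> real \<Rightarrow> complex" where
  "diff_expr n p Y x = Y n x + (\<Sum>j=1..n. p j x * Y (n - j) x)"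

definition deriv_family :: "nat \<Rightarrow> (nat \<Rightarrow> real \<Rightarrow> complex) \<Rightarrow> bool" where
  "deriv_family n Y \<longleftrightarrow>
     (\<forall>k<n. AC_loc (Y k)) \<and>
     (\<forall>k<n. AE x in Rplus. (Y k has_vector_derivative Y (Suc k) x) (at x within {0..}))"

definition L0_graph :: "nat \<Rightarrow> (nat \<Rightarrow> real \<Rightarrow> complex) \<Rightarrow> ((real \<Rightarrow> complex) \<times> (real \<Rightarrow> complex)) set" where
  "L0_graph n p = {(Y 0, diff_expr n p Y) | Y.
      L2 (Y 0) \<and> deriv_family n Y \<and> L2 (diff_expr n p Y) \<and>
      (\<forall>k<n. Y k 0 = 0) \<and> (\<exists>x0>0. \<forall>x\<ge>x0. Y 0 x = 0)}"

end

theory Submission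
  imports Defs
begin

text \<open>
  Suppose that the integrals do not tend to infinity. Then they stay below some \<open>M\<close> on infinitely many
  \<open>D\<^sub>k\<close>. On a subinterval of \<open>D\<^sub>k\<close> of small length \<open>\<delta>\<close> the lower order terms of \<open>l\<close> have size
  \<open>\<delta> (|C\<^sub>0| + M)\<close> relative to \<open>y\<^sup>(\<^sup>n\<^sup>)\<close>, hence are a small perturbation, uniformly in \<open>k\<close>. Solving
  \<open>l(y) = f\<close> with zero initial data for \<open>f\<close> in an \<open>(n+1)\<close>-dimensional space of step functions, one finds
  a nonzero \<open>f\<close> for which \<open>y\<close> also satisfies the \<open>n\<close> zero conditions at the right end point. If the
  largest coefficient of \<open>f\<close> has modulus one, then \<open>l(y)\<close> is bounded by one, while the \<open>n\<close>-th finite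
  difference of \<open>y\<close> on the corresponding step is bounded from below. So \<open>\<parallel>y\<parallel>\<close> and \<open>\<parallel>l(y)\<parallel>\<close> are bounded
  and \<open>\<parallel>y\<parallel>\<close> is bounded away from zero uniformly in \<open>k\<close>. Since the functions \<open>y\<close> have disjoint supports,
  they have no convergent subsequence, which contradicts the compactness of the resolvent.
\<close>

subsection \<open>Linear systems and finite differences\<close>

text \<open>Gaussian elimination: an equation \<open>k\<close> with a nonzero coefficient at
  \<open>i0\<close> removes that unknown from the others, which leaves one equation and one unknown
  fewer. It is applied below to \<open>n\<close> end conditions and \<open>n + 1\<close> step
  coefficients.\<close>

lemma homogeneous_system_nontrivial_solution:
  fixes M :: "'k \<Rightarrow> 'i \<Rightarrow> 'a::field"
  assumes "finite K" "finite I" "card K < card I"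
  shows "\<exists>c. (\<exists>i\<in>I. c i \<noteq> 0) \<and> (\<forall>k\<in>K. (\<Sum>i\<in>I. c i * M k i) = 0)"
  using assms
proof (induction K arbitrary: I M rule: finite_induct)
  case empty
  then obtain i where "i \<in> I" by fastforce
  then show ?case by (intro exI[of _ "\<lambda>_. 1"]) auto
next
  case (insert k K)
  show ?case
  proof (cases "\<forall>i\<in>I. M k i = 0")
    case True
    have "card K < card I" using insert.prems insert.hyps by simp
    then obtain c where "\<exists>i\<in>I. c i \<noteq> 0" "\<forall>k\<in>K. (\<Sum>i\<in>I. c i * M k i) = 0"
      using insert.IH[OF insert.prems(1), of M] by blast
    with True show ?thesis by (intro exI[of _ c]) auto
  next
    case False
    then obtain i0 where i0: "i0 \<in> I" "M k i0 \<noteq> 0" by blast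
    define J where "J = I - {i0}"
    have J: "finite J" "card K < card J" "i0 \<notin> J" "I = insert i0 J"
      using insert.prems insert.hyps i0 by (auto simp: J_def card_Diff_singleton)
    obtain c where c: "\<exists>i\<in>J. c i \<noteq> 0"
      "\<forall>l\<in>K. (\<Sum>i\<in>J. c i * (M l i - M l i0 * M k i / M k i0)) = 0"
      using insert.IH[OF J(1,2), of "\<lambda>l i. M l i - M l i0 * M k i / M k i0"] by blast
    \<comment> \<open>The value that equation \<open>k\<close> forces on the eliminated unknown
      \<open>i0\<close>.\<close>
    define t where "t = - (\<Sum>i\<in>J. c i * M k i) / M k i0"
    define c' where "c' = c(i0 := t)"
    have eq: "(\<Sum>i\<in>I. c' i * M l i) = t * M l i0 + (\<Sum>i\<in>J. c i * M l i)" for l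
    proof -
      have "(\<Sum>i\<in>J. c' i * M l i) = (\<Sum>i\<in>J. c i * M l i)"
        using J(3) by (intro sum.cong) (auto simp: c'_def)
      then show ?thesis
        using J by (simp add: c'_def)
    qed
    have "(\<Sum>i\<in>I. c' i * M k i) = 0"
      unfolding eq t_def using i0 by simp
    moreover have "(\<Sum>i\<in>I. c' i * M l i) = 0" if "l \<in> K" for l
    proof -
      have "0 = (\<Sum>i\<in>J. c i * M l i) - (\<Sum>i\<in>J. c i * M k i) * M l i0 / M k i0"
        using c(2)[rule_format, OF that]
        by (simp add: algebra_simps sum_subtractf sum_distrib_left sum_distrib_right sum_divide_distrib)
      then show ?thesis unfolding eq t_def by (simp add: algebra_simps)
    qed
    moreover have "\<exists>i\<in>I. c' i \<noteq> 0"
      using c(1) J by (auto simp: c'_def)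
    ultimately show ?thesis by blast
  qed
qed

text \<open>Induction through the difference \<phi>(x + s) - \<phi>(x): the mean value theorem
  lowers the order of the derivative by one and yields a factor \<open>s\<close>, while passing from
  a difference to one of its two terms costs a factor 2. Only increments of \<open>\<phi> m\<close>
  enter, which suits y^(n-1), a function that need not be differentiable everywhere.\<close>

lemma finite_difference_lower_bound:
  fixes \<phi> :: "nat \<Rightarrow> real \<Rightarrow> real"
  assumes "s > 0"
    and "\<And>k x. k < m \<Longrightarrow> x \<in> {\<alpha>..\<alpha> + (real m + 1) * s} \<Longrightarrow>
           (\<phi> k has_real_derivative \<phi> (Suc k) x) (at x within {\<alpha>..\<alpha> + (real m + 1) * s})"
    and "\<And>x. x \<in> {\<alpha>..\<alpha> + real m * s} \<Longrightarrow> \<phi> m (x + s) - \<phi> m x \<ge> r"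
  shows "\<exists>x\<in>{\<alpha>..\<alpha> + (real m + 1) * s}. \<bar>\<phi> 0 x\<bar> \<ge> s ^ m * r / 2 ^ (m + 1)"
  using assms(2,3)
proof (induction m arbitrary: \<phi> r)
  case 0
  have "\<phi> 0 (\<alpha> + s) - \<phi> 0 \<alpha> \<ge> r" using 0(2)[of \<alpha>] by simp
  then have "\<bar>\<phi> 0 (\<alpha> + s)\<bar> \<ge> r / 2 \<or> \<bar>\<phi> 0 \<alpha>\<bar> \<ge> r / 2" by linarith
  then show ?case using \<open>s > 0\<close> by (auto intro: bexI[of _ "\<alpha> + s"] bexI[of _ \<alpha>])
next
  case (Suc m)
  let ?I = "{\<alpha>..\<alpha> + (real (Suc m) + 1) * s}"
  let ?J = "{\<alpha>..\<alpha> + (real m + 1) * s}"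
  define \<psi> where "\<psi> = (\<lambda>k x. \<phi> k (x + s) - \<phi> k x)"
  have JI: "x \<in> ?I" "x + s \<in> ?I" if "x \<in> ?J" for x
    using that \<open>s > 0\<close> by (auto simp: algebra_simps)
  have der: "(\<psi> k has_real_derivative \<psi> (Suc k) x) (at x within ?J)" if "k < Suc m" "x \<in> ?J" for k x
  proof -
    have JI': "?J \<subseteq> ?I" "(\<lambda>y. y + s) ` ?J \<subseteq> ?I" using JI by blast+
    have 1: "(\<phi> k has_real_derivative \<phi> (Suc k) x) (at x within ?J)"
      by (rule DERIV_subset[OF Suc.prems(1)]) (use that JI JI' in blast)+
    have "(\<phi> k has_real_derivative \<phi> (Suc k) (x + s)) (at (x + s) within (\<lambda>y. y + s) ` ?J)"
      by (rule DERIV_subset[OF Suc.prems(1)]) (use that JI JI' in blast)+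
    then have "((\<phi> k \<circ> (\<lambda>y. y + s)) has_real_derivative \<phi> (Suc k) (x + s) * 1) (at x within ?J)"
      by (intro DERIV_image_chain) (auto intro!: derivative_eq_intros)
    from DERIV_diff[OF this 1] show ?thesis by (simp add: \<psi>_def o_def)
  qed
  have "\<exists>x\<in>?J. \<bar>\<psi> 0 x\<bar> \<ge> s ^ m * (s * r) / 2 ^ (m + 1)"
  proof (rule Suc.IH)
    show "(\<psi> k has_real_derivative \<psi> (Suc k) x) (at x within ?J)" if "k < m" "x \<in> ?J" for k x
      using der that by simp
    fix x assume x: "x \<in> {\<alpha>..\<alpha> + real m * s}"
    have xs: "{x..x+s} \<subseteq> ?J" using x by (auto simp: algebra_simps)
    have d: "(\<psi> m has_real_derivative \<psi> (Suc m) y) (at y within {x..x+s})" if "y \<in> {x..x+s}" for y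
      by (rule DERIV_subset[OF der]) (use that xs in auto)
    have "\<exists>z\<in>{x<..<x + s}. \<psi> m (x + s) - \<psi> m x = \<psi> (Suc m) z * (x + s - x)"
      by (rule mvt_simple) (use \<open>s > 0\<close> d in \<open>auto simp: has_field_derivative_def\<close>)
    then obtain z where z: "x < z" "z < x + s" "\<psi> m (x + s) - \<psi> m x = s * \<psi> (Suc m) z" by auto
    have "z \<in> ?J" using z xs by auto
    then have "\<psi> (Suc m) z \<ge> r" using Suc.prems(2)[of z] by (simp add: \<psi>_def algebra_simps)
    then show "\<psi> m (x + s) - \<psi> m x \<ge> s * r" using z \<open>s > 0\<close> by simp
  qed
  then obtain x where x: "x \<in> ?J" "\<bar>\<psi> 0 x\<bar> \<ge> s ^ m * (s * r) / 2 ^ (m + 1)" by blast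
  have "\<bar>\<psi> 0 x\<bar> \<le> \<bar>\<phi> 0 (x + s)\<bar> + \<bar>\<phi> 0 x\<bar>" by (simp add: \<psi>_def)
  moreover have "s ^ m * (s * r) / 2 ^ (m + 1) = 2 * (s ^ Suc m * r / 2 ^ (Suc m + 1))" by simp
  ultimately have "\<bar>\<phi> 0 (x + s)\<bar> \<ge> s ^ Suc m * r / 2 ^ (Suc m + 1) \<or> \<bar>\<phi> 0 x\<bar> \<ge> s ^ Suc m * r / 2 ^ (Suc m + 1)"
    using x(2) by linarith
  then show ?case using JI[OF x(1)] by blast
qed

subsection \<open>Indefinite integrals of integrable functions\<close>

text \<open>Each exceptional set is covered, up to a null set, by a disjoint Vitali family of intervals on
  which the increment of the integral is far from \<open>f(x)\<close> times the length; by Henstock's lemma the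
  total length of these intervals is arbitrarily small.\<close>

lemma negligible_not_derivative_indefinite_integral:
  fixes f :: "real \<Rightarrow> 'a::euclidean_space"
  assumes f: "f integrable_on {a..b}"
  shows "negligible {x \<in> {a<..<b}. \<not> ((\<lambda>x. integral {a..x} f) has_vector_derivative f x) (at x)}"
proof -
  define F where "F = (\<lambda>x. integral {a..x} f)"
  define E where "E = (\<lambda>e. {x \<in> {a<..<b}. \<forall>d>0. \<exists>y\<in>{a<..<b}. y \<noteq> x \<and> \<bar>y - x\<bar> < d \<and>
        norm (F y - F x - (y - x) *\<^sub>R f x) \<ge> e * \<bar>y - x\<bar>})"
  have negE: "negligible (E e)" if "e > 0" for e
    unfolding negligible_outer_le
  proof (intro allI impI)
    fix \<epsilon> :: real assume "\<epsilon> > 0"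
    obtain \<gamma> where \<gamma>: "gauge \<gamma>"
      "\<And>P. \<lbrakk>P tagged_partial_division_of (cbox a b); \<gamma> fine P\<rbrakk> \<Longrightarrow>
             (\<Sum>(x,k)\<in>P. norm (Henstock_Kurzweil_Integration.content k *\<^sub>R f x - integral k f)) < e * \<epsilon>"
      using Henstock_lemma[of f a b "e * \<epsilon>"] f \<open>e > 0\<close> \<open>\<epsilon> > 0\<close> by auto
    \<comment> \<open>A pair consists of a tag \<open>x\<close> and a second end point
      \<open>y\<close>; the gauge condition makes finite disjoint subfamilies fine, so that
      Henstock's lemma applies to them.\<close>
    define K where "K = {(x,y). x \<in> {a<..<b} \<and> y \<in> {a<..<b} \<and> x \<noteq> y \<and> {min x y..max x y} \<subseteq> \<gamma> x \<and>
        norm (F y - F x - (y - x) *\<^sub>R f x) \<ge> e * \<bar>y - x\<bar>}"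
    \<comment> \<open>The interval between \<open>x\<close> and \<open>y\<close> is coded as a ball
      around its midpoint, the form in which Vitali's theorem takes it.\<close>
    define c where "c = (\<lambda>(x,y). (x + y) / 2 :: real)"
    define r where "r = (\<lambda>(x,y). \<bar>y - x\<bar> / 2 :: real)"
    have cb: "cball (c (x,y)) (r (x,y)) = {min x y..max x y}" for x y
      by (auto simp: c_def r_def cball_eq_atLeastAtMost min_def max_def abs_if field_simps)
    obtain C where C: "countable C" "C \<subseteq> K"
      "pairwise (\<lambda>i j. disjnt (cball (c i) (r i)) (cball (c j) (r j))) C"
      "negligible (E e - (\<Union>i\<in>C. cball (c i) (r i)))"
    proof (rule Vitali_covering_theorem_cballs[of K r "E e" c])
      show "0 < r i" if "i \<in> K" for i using that by (auto simp: K_def r_def)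
      fix x d :: real assume x: "x \<in> E e" and "0 < d"
      have "open (\<gamma> x)" "x \<in> \<gamma> x" using \<gamma>(1) by (auto simp: gauge_def)
      then obtain \<delta> where \<delta>: "\<delta> > 0" "ball x \<delta> \<subseteq> \<gamma> x" by (meson openE)
      have "min d \<delta> > 0" using \<open>0 < d\<close> \<delta>(1) by simp
      moreover have "\<forall>d>0. \<exists>y\<in>{a<..<b}. y \<noteq> x \<and> \<bar>y - x\<bar> < d \<and>
          norm (F y - F x - (y - x) *\<^sub>R f x) \<ge> e * \<bar>y - x\<bar>"
        using x unfolding E_def by blast
      ultimately obtain y where y: "y \<in> {a<..<b}" "y \<noteq> x" "\<bar>y - x\<bar> < min d \<delta>"
        "norm (F y - F x - (y - x) *\<^sub>R f x) \<ge> e * \<bar>y - x\<bar>"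
        by blast
      have "{min x y..max x y} \<subseteq> ball x \<delta>"
        using y(3) \<delta>(1) by (auto simp: dist_real_def min_def max_def abs_if split: if_splits)
      then have "(x,y) \<in> K" using y x \<delta>(2) by (auto simp: K_def E_def)
      moreover have "x \<in> cball (c (x,y)) (r (x,y))" unfolding cb by auto
      moreover have "r (x,y) < d" using y(2,3) by (auto simp: r_def)
      ultimately show "\<exists>i. i \<in> K \<and> x \<in> cball (c i) (r i) \<and> r i < d" by blast
    qed
    let ?D = "(\<lambda>i. cball (c i) (r i)) ` C"
    \<comment> \<open>The bound passes from finite subunions to the countable union, so only finite
      disjoint families have to be measured.\<close>
    have fin: "measure lebesgue (\<Union>D') \<le> \<epsilon>" if D': "D' \<subseteq> ?D" "finite D'" for D'
    proof -
      obtain C' where C': "C' \<subseteq> C" "finite C'" "D' = (\<lambda>i. cball (c i) (r i)) ` C'"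
        using finite_subset_image[OF D'(2,1)] by blast
      define P where "P = (\<lambda>i. (fst i, cball (c i) (r i))) ` C'"
      have disj: "i = j \<or> cball (c i) (r i) \<inter> cball (c j) (r j) = {}" if "i \<in> C'" "j \<in> C'" for i j
        using C(3) that C'(1) unfolding pairwise_def disjnt_def by blast
      have ne: "cball (c i) (r i) \<noteq> {}" if "i \<in> C'" for i
        using that C'(1) C(2) by (auto simp: K_def r_def)
      have inj: "inj_on (\<lambda>i. (fst i, cball (c i) (r i))) C'"
        using disj ne by (fastforce simp: inj_on_def)
      have "P tagged_partial_division_of (cbox a b)"
        unfolding tagged_partial_division_of_def
      proof (intro conjI allI impI)
        show "finite P" using C' by (simp add: P_def)
      next
        fix x k assume "(x,k) \<in> P"
        then obtain y where xy: "(x,y) \<in> C'" "k = {min x y..max x y}" by (auto simp: P_def cb)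
        then have "(x,y) \<in> K" using C'(1) C(2) by auto
        then show "x \<in> k" "k \<subseteq> cbox a b" "\<exists>a b. k = cbox a b"
          using xy by (auto simp: K_def)
      next
        fix x1 k1 x2 k2 assume h: "(x1,k1) \<in> P \<and> (x2,k2) \<in> P \<and> (x1,k1) \<noteq> (x2,k2)"
        then obtain i j where ij: "i \<in> C'" "j \<in> C'" "(x1,k1) = (fst i, cball (c i) (r i))"
           "(x2,k2) = (fst j, cball (c j) (r j))"
          unfolding P_def by blast
        with h have "i \<noteq> j" by auto
        then have "k1 \<inter> k2 = {}" using disj[of i j] ij by auto
        then show "interior k1 \<inter> interior k2 = {}"
          using interior_subset by blast
      qed
      moreover have "\<gamma> fine P"
      proof (rule fineI)
        fix x k assume "(x,k) \<in> P"
        then obtain y where xy: "(x,y) \<in> C'" "k = {min x y..max x y}" by (auto simp: P_def cb)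
        then have "(x,y) \<in> K" using C'(1) C(2) by auto
        then show "k \<subseteq> \<gamma> x" using xy by (auto simp: K_def)
      qed
      ultimately have "(\<Sum>(x,k)\<in>P. norm (Henstock_Kurzweil_Integration.content k *\<^sub>R f x - integral k f)) < e * \<epsilon>"
        by (rule \<gamma>(2))
      also have "(\<Sum>(x,k)\<in>P. norm (Henstock_Kurzweil_Integration.content k *\<^sub>R f x - integral k f)) =
          (\<Sum>i\<in>C'. norm (Henstock_Kurzweil_Integration.content (cball (c i) (r i)) *\<^sub>R f (fst i) - integral (cball (c i) (r i)) f))"
        unfolding P_def by (subst sum.reindex[OF inj]) (simp add: case_prod_unfold)
      finally have lt: "(\<Sum>i\<in>C'. norm (Henstock_Kurzweil_Integration.content (cball (c i) (r i)) *\<^sub>R f (fst i) - integral (cball (c i) (r i)) f)) < e * \<epsilon>" .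
      \<comment> \<open>Every chosen interval misses the linear approximation by at least
        \<open>e\<close> times its length. Comparison with the bound \<open>e * \<epsilon>\<close>
        gives total length below \<epsilon>.\<close>
      have ge: "e * measure lebesgue (cball (c i) (r i)) \<le>
          norm (Henstock_Kurzweil_Integration.content (cball (c i) (r i)) *\<^sub>R f (fst i) - integral (cball (c i) (r i)) f)" if "i \<in> C'" for i
      proof -
        obtain x y where i: "i = (x,y)" by fastforce
        have K: "(x,y) \<in> K" using that i C'(1) C(2) by auto
        have comb: "F u + integral {u..v} f = F v" if "a < u" "u \<le> v" "v < b" for u v
          unfolding F_def using that
          by (intro Henstock_Kurzweil_Integration.integral_combine integrable_on_subinterval[OF f]) auto
        show ?thesis
        proof (cases "x < y")
          case True
          then have "integral {x..y} f = F y - F x" using comb[of x y] K by (auto simp: K_def algebra_simps)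
          then show ?thesis using True K unfolding i cb by (auto simp: K_def norm_minus_commute)
        next
          case False
          then have "y < x" using K by (auto simp: K_def)
          then have "integral {y..x} f = F x - F y" using comb[of y x] K by (auto simp: K_def algebra_simps)
          moreover have "e * \<bar>y - x\<bar> \<le> norm (F y - F x - (y - x) *\<^sub>R f x)"
            using K by (simp add: K_def)
          moreover have "F y - F x - (y - x) *\<^sub>R f x = (x - y) *\<^sub>R f x - (F x - F y)"
            by (simp add: scaleR_diff_left)
          ultimately have "e * \<bar>y - x\<bar> \<le> norm ((x - y) *\<^sub>R f x - integral {y..x} f)" by simp
          then show ?thesis using \<open>y < x\<close> unfolding i cb by auto
        qed
      qed
      have "e * measure lebesgue (\<Union>D') \<le> e * (\<Sum>i\<in>C'. measure lebesgue (cball (c i) (r i)))"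
        unfolding C'(3) using \<open>e > 0\<close>
        by (intro mult_left_mono measure_UNION_le) (use C' in auto)
      also have "\<dots> \<le> (\<Sum>i\<in>C'. norm (Henstock_Kurzweil_Integration.content (cball (c i) (r i)) *\<^sub>R f (fst i) - integral (cball (c i) (r i)) f))"
        unfolding sum_distrib_left by (intro sum_mono ge)
      also note lt
      finally show ?thesis using \<open>e > 0\<close> by simp
    qed
    have U: "\<Union>?D \<in> lmeasurable" "measure lebesgue (\<Union>?D) \<le> \<epsilon>"
      by (rule fmeasurable_Union_bound measure_Union_bound, use C(1) fin in auto)+
    let ?T = "\<Union>?D \<union> (E e - \<Union>?D)"
    have N: "negligible (E e - \<Union>?D)" using C(4) by simp
    have "?T \<in> lmeasurable" by (rule fmeasurable.Un[OF U(1) negligible_imp_measurable[OF N]])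
    moreover have "measure lebesgue ?T \<le> \<epsilon>"
      using measure_Un_le[of "\<Union>?D" lebesgue "E e - \<Union>?D"] U N
      by (auto simp: negligible_imp_measure0 negligible_imp_sets fmeasurableD)
    moreover have "E e \<subseteq> ?T" by blast
    ultimately show "\<exists>T. E e \<subseteq> T \<and> T \<in> lmeasurable \<and> measure lebesgue T \<le> \<epsilon>" by blast
  qed
  have "{x \<in> {a<..<b}. \<not> (F has_vector_derivative f x) (at x)} \<subseteq> (\<Union>m. E (inverse (real (Suc m))))"
  proof
    fix x assume x: "x \<in> {x \<in> {a<..<b}. \<not> (F has_vector_derivative f x) (at x)}"
    show "x \<in> (\<Union>m. E (inverse (real (Suc m))))"
    proof (rule ccontr)
      assume n: "x \<notin> (\<Union>m. E (inverse (real (Suc m))))"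
      have "(F has_vector_derivative f x) (at x)"
        unfolding has_vector_derivative_def has_derivative_at_alt
      proof (intro conjI allI impI)
        show "bounded_linear (\<lambda>h. h *\<^sub>R f x)" by (rule bounded_linear_scaleR_left)
      next
        fix e :: real assume "e > 0"
        then obtain m where m: "inverse (real (Suc m)) < e" using reals_Archimedean by blast
        have "x \<notin> E (inverse (real (Suc m)))" using n by blast
        then obtain d where d: "d > 0" "\<And>y. \<lbrakk>y \<in> {a<..<b}; y \<noteq> x; \<bar>y - x\<bar> < d\<rbrakk> \<Longrightarrow>
             norm (F y - F x - (y - x) *\<^sub>R f x) < inverse (real (Suc m)) * \<bar>y - x\<bar>"
          using x unfolding E_def by (smt (verit) mem_Collect_eq)
        define d' where "d' = min d (min (x - a) (b - x))"
        have "norm (F y - F x - (y - x) *\<^sub>R f x) \<le> e * norm (y - x)" if "norm (y - x) < d'" for y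
        proof (cases "y = x")
          case False
          have "norm (F y - F x - (y - x) *\<^sub>R f x) < inverse (real (Suc m)) * \<bar>y - x\<bar>"
            using that False by (intro d) (auto simp: d'_def)
          also have "\<dots> \<le> e * \<bar>y - x\<bar>" using m by (intro mult_right_mono) auto
          finally show ?thesis by simp
        qed simp
        moreover have "d' > 0" using d x by (auto simp: d'_def)
        ultimately show "\<exists>d>0. \<forall>y. norm (y - x) < d \<longrightarrow> norm (F y - F x - (y - x) *\<^sub>R f x) \<le> e * norm (y - x)"
          by blast
      qed
      then show False using x by blast
    qed
  qed
  moreover have "negligible (\<Union>m. E (inverse (real (Suc m))))"
    by (intro negligible_countable_Union) (auto intro: negE)
  ultimately show ?thesis unfolding F_def by (rule negligible_subset[rotated])
qed

text \<open>At each point the excess over \<open>k\<close> vanishes once \<open>k\<close> reaches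
  the norm of \<open>g x\<close>, and it is dominated by that norm, so dominated convergence
  applies. The result splits \<open>g\<close> into a bounded part and a part with small
  integral.\<close>

lemma absolutely_integrable_truncation:
  fixes g :: "real \<Rightarrow> 'a::euclidean_space"
  assumes g: "g absolutely_integrable_on {a..b}" and "e > 0"
  obtains N :: real where "N \<ge> 0" "(\<lambda>x. max 0 (norm (g x) - N)) integrable_on {a..b}"
    "integral {a..b} (\<lambda>x. max 0 (norm (g x) - N)) < e"
proof -
  let ?h = "\<lambda>k x. max 0 (norm (g x) - real k)"
  have ng: "(\<lambda>x. norm (g x)) absolutely_integrable_on {a..b}"
    using absolutely_integrable_norm[OF g] by (simp add: o_def)
  have int: "?h k integrable_on {a..b}" for k
    by (intro set_lebesgue_integral_eq_integral(1) absolutely_integrable_max_1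
        set_integral_diff(1) ng absolutely_integrable_on_const) auto
  have "(\<lambda>k. integral {a..b} (?h k)) \<longlonglongrightarrow> integral {a..b} (\<lambda>x. 0)"
  proof (rule dominated_convergence(2)[where h="\<lambda>x. norm (g x)"])
    show "(\<lambda>x. norm (g x)) integrable_on {a..b}"
      using ng set_lebesgue_integral_eq_integral(1) by blast
    fix x
    have "\<forall>\<^sub>F k in sequentially. ?h k x = 0"
    proof (rule eventually_sequentiallyI[of "nat \<lceil>norm (g x)\<rceil>"])
      fix k assume "nat \<lceil>norm (g x)\<rceil> \<le> k"
      then have "norm (g x) \<le> real k" by linarith
      then show "?h k x = 0" by simp
    qed
    then show "(\<lambda>k. ?h k x) \<longlonglongrightarrow> 0" by (rule tendsto_eventually)
  qed (use int in auto)
  then have "\<forall>\<^sub>F k in sequentially. integral {a..b} (?h k) < e"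
    using \<open>e > 0\<close> by (intro order_tendstoD(2)) auto
  then obtain k where "integral {a..b} (?h k) < e"
    by (auto simp: eventually_sequentially)
  then show ?thesis using int that[of "real k"] by simp
qed

text \<open>After truncation at \<open>N\<close>, the bounded part contributes at most
  \<open>N\<close> times the total length, and the excess at most its integral over {a..b}, because
  the intervals do not overlap.\<close>

lemma abs_cont_on_interval_indefinite_integral:
  fixes g :: "real \<Rightarrow> 'a::euclidean_space"
  assumes g: "g absolutely_integrable_on {a..b}"
    and F: "\<And>u v. a \<le> u \<Longrightarrow> u \<le> v \<Longrightarrow> v \<le> b \<Longrightarrow> F v - F u = integral {u..v} g"
  shows "abs_cont_on_interval a b F"
  unfolding abs_cont_on_interval_def
proof (intro allI impI)
  fix \<epsilon> :: real assume "\<epsilon> > 0"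
  then obtain N where N: "N \<ge> 0" "(\<lambda>x. max 0 (norm (g x) - N)) integrable_on {a..b}"
    "integral {a..b} (\<lambda>x. max 0 (norm (g x) - N)) < \<epsilon> / 2"
    using absolutely_integrable_truncation[OF g, of "\<epsilon> / 2"] by auto
  let ?h = "\<lambda>x. max 0 (norm (g x) - N)"
  show "\<exists>\<delta>>0. \<forall>(m::nat) u v.
             (\<forall>i<m. a \<le> u i \<and> u i \<le> v i \<and> v i \<le> b) \<and>
             (\<forall>i<m. \<forall>j<m. i \<noteq> j \<longrightarrow> v i \<le> u j \<or> v j \<le> u i) \<and>
             (\<Sum>i<m. v i - u i) < \<delta> \<longrightarrow>
             (\<Sum>i<m. norm (F (v i) - F (u i))) < \<epsilon>"
  \<comment> \<open>Using \<open>N + 1\<close> keeps the denominator positive when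
    \<open>N = 0\<close>.\<close>
  proof (intro exI[of _ "\<epsilon> / (2 * (N + 1))"] conjI allI impI)
    show "0 < \<epsilon> / (2 * (N + 1))" using \<open>\<epsilon> > 0\<close> N(1) by simp
    fix m :: nat and u v :: "nat \<Rightarrow> real"
    assume "(\<forall>i<m. a \<le> u i \<and> u i \<le> v i \<and> v i \<le> b) \<and>
             (\<forall>i<m. \<forall>j<m. i \<noteq> j \<longrightarrow> v i \<le> u j \<or> v j \<le> u i) \<and>
             (\<Sum>i<m. v i - u i) < \<epsilon> / (2 * (N + 1))"
    then have uv: "\<And>i. i < m \<Longrightarrow> a \<le> u i" "\<And>i. i < m \<Longrightarrow> u i \<le> v i" "\<And>i. i < m \<Longrightarrow> v i \<le> b"
      and disj: "\<And>i j. i < m \<Longrightarrow> j < m \<Longrightarrow> i \<noteq> j \<Longrightarrow> v i \<le> u j \<or> v j \<le> u i"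
      and small: "(\<Sum>i<m. v i - u i) < \<epsilon> / (2 * (N + 1))" by auto
    have hint: "?h integrable_on {u i..v i}" if "i < m" for i
      by (rule integrable_on_subinterval[OF N(2)]) (use uv that in auto)
    have piece: "norm (F (v i) - F (u i)) \<le> N * (v i - u i) + integral {u i..v i} ?h" if i: "i < m" for i
    proof -
      have gi: "g absolutely_integrable_on {u i..v i}"
        by (rule absolutely_integrable_on_subinterval[OF g]) (use uv i in auto)
      have "norm (F (v i) - F (u i)) \<le> integral {u i..v i} (\<lambda>x. N + ?h x)"
        unfolding F[OF uv[OF i]]
        by (rule integral_norm_bound_integral)
           (use gi hint[OF i] in \<open>auto intro!: integrable_add simp: set_lebesgue_integral_eq_integral(1)\<close>)
      also have "\<dots> = N * (v i - u i) + integral {u i..v i} ?h"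
        using hint[OF i] uv(2)[OF i] by (subst integral_add) auto
      finally show ?thesis .
    qed
    \<comment> \<open>Neighbouring intervals may share end points. Their interiors are disjoint, so
      at each point at most one summand survives.\<close>
    have "(\<Sum>i<m. integral {u i..v i} ?h) = (\<Sum>i<m. integral {a..b} (\<lambda>x. if x \<in> {u i<..<v i} then ?h x else 0))"
    proof (rule sum.cong[OF refl])
      fix i assume i: "i \<in> {..<m}"
      have "integral {a..b} (\<lambda>x. if x \<in> {u i<..<v i} then ?h x else 0) = integral ({u i<..<v i} \<inter> {a..b}) ?h"
        by (rule integral_restrict_Int)
      also have "{u i<..<v i} \<inter> {a..b} = {u i<..<v i}" using uv i by force
      finally show "integral {u i..v i} ?h = integral {a..b} (\<lambda>x. if x \<in> {u i<..<v i} then ?h x else 0)"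
        using integral_open_interval_real[of "u i" "v i" ?h] by simp
    qed
    also have "\<dots> = integral {a..b} (\<lambda>x. \<Sum>i<m. if x \<in> {u i<..<v i} then ?h x else 0)"
    proof (rule integral_sum[symmetric])
      fix i assume i: "i \<in> {..<m}"
      have "?h integrable_on {u i<..<v i}" using hint i by (simp add: integrable_on_open_interval_real)
      moreover have "{u i<..<v i} \<inter> {a..b} = {u i<..<v i}" using uv i by force
      ultimately show "(\<lambda>x. if x \<in> {u i<..<v i} then ?h x else 0) integrable_on {a..b}"
        by (simp only: integrable_restrict_Int)
    qed simp
    also have "\<dots> \<le> integral {a..b} ?h"
    proof (rule integral_le)
      show "(\<lambda>x. \<Sum>i<m. if x \<in> {u i<..<v i} then ?h x else 0) integrable_on {a..b}"
      proof (rule integrable_sum)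
        fix i assume i: "i \<in> {..<m}"
        have "?h integrable_on {u i<..<v i}" using hint i by (simp add: integrable_on_open_interval_real)
        moreover have "{u i<..<v i} \<inter> {a..b} = {u i<..<v i}" using uv i by force
        ultimately show "(\<lambda>x. if x \<in> {u i<..<v i} then ?h x else 0) integrable_on {a..b}"
          by (simp only: integrable_restrict_Int)
      qed simp
      fix x assume "x \<in> {a..b}"
      show "(\<Sum>i<m. if x \<in> {u i<..<v i} then ?h x else 0) \<le> ?h x"
      proof (cases "\<exists>i<m. x \<in> {u i<..<v i}")
        case True
        then obtain i where i: "i < m" "x \<in> {u i<..<v i}" by blast
        have "(\<Sum>j<m. if x \<in> {u j<..<v j} then ?h x else 0) = (\<Sum>j<m. if j = i then ?h x else 0)"
        proof (rule sum.cong[OF refl])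
          fix j assume "j \<in> {..<m}"
          then show "(if x \<in> {u j<..<v j} then ?h x else 0) = (if j = i then ?h x else 0)"
            using disj[of i j] i by (cases "j = i") auto
        qed
        also have "\<dots> \<le> ?h x" using i by simp
        finally show ?thesis .
      next
        case False
        then have "(\<Sum>i<m. if x \<in> {u i<..<v i} then ?h x else 0) = 0"
          by (intro sum.neutral) auto
        then show ?thesis by simp
      qed
    qed (rule N(2))
    finally have hsum: "(\<Sum>i<m. integral {u i..v i} ?h) < \<epsilon> / 2" using N(3) by simp
    have "(\<Sum>i<m. norm (F (v i) - F (u i))) \<le> (\<Sum>i<m. N * (v i - u i) + integral {u i..v i} ?h)"
      by (intro sum_mono piece) auto
    also have "\<dots> = N * (\<Sum>i<m. v i - u i) + (\<Sum>i<m. integral {u i..v i} ?h)"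
      by (simp only: sum.distrib sum_distrib_left)
    finally have le: "(\<Sum>i<m. norm (F (v i) - F (u i))) \<le> \<dots>" .
    have "N * (\<Sum>i<m. v i - u i) \<le> (N + 1) * (\<epsilon> / (2 * (N + 1)))"
      using small N(1) uv(2) by (intro mult_mono) (auto intro!: sum_nonneg)
    also have "\<dots> = \<epsilon> / 2" using N(1) by (simp add: field_simps add_nonneg_eq_0_iff)
    finally show "(\<Sum>i<m. norm (F (v i) - F (u i))) < \<epsilon>" using hsum le by linarith
  qed
qed

text \<open>These are the two conditions that \<open>deriv_family\<close> puts on consecutive
  derivatives. The exceptional null sets on the intervals (0, m+1) are united, together with the
  point 0.\<close>

lemma indefinite_integral_AC_loc_AE_derivative:
  fixes g :: "real \<Rightarrow> complex"
  assumes g: "\<And>b. 0 \<le> b \<Longrightarrow> g absolutely_integrable_on {0..b}"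
    and F: "\<And>x. 0 \<le> x \<Longrightarrow> F x = integral {0..x} g"
  shows "AC_loc F" and "AE x in Rplus. (F has_vector_derivative g x) (at x within {0..})"
proof -
  have gi: "g integrable_on {u..v}" if "0 \<le> u" "0 \<le> v" for u v
    by (rule integrable_on_subinterval[where S="{0..v}"])
       (use that g in \<open>auto intro: set_lebesgue_integral_eq_integral(1)\<close>)
  show "AC_loc F"
    unfolding AC_loc_def
  proof (intro allI impI)
    fix a b :: real assume ab: "0 \<le> a" "a \<le> b"
    show "abs_cont_on_interval a b F"
    proof (rule abs_cont_on_interval_indefinite_integral)
      show "g absolutely_integrable_on {a..b}"
        by (rule absolutely_integrable_on_subinterval[OF g[of b]]) (use ab in auto)
      fix u v assume "a \<le> u" "u \<le> v" "v \<le> b"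
      then have "integral {0..u} g + integral {u..v} g = integral {0..v} g"
        using ab by (intro Henstock_Kurzweil_Integration.integral_combine gi) auto
      then show "F v - F u = integral {u..v} g"
        using \<open>a \<le> u\<close> \<open>u \<le> v\<close> ab F[of u] F[of v] by (simp add: algebra_simps)
    qed
  qed
  define B where "B = (\<lambda>m. {x \<in> {0<..<real (Suc m)}. \<not> ((\<lambda>x. integral {0..x} g) has_vector_derivative g x) (at x)})"
  have "negligible (B m)" for m
    unfolding B_def by (rule negligible_not_derivative_indefinite_integral) (auto intro: gi)
  then have "negligible (insert 0 (\<Union>m. B m))"
    by (intro negligible_insert[THEN iffD2] negligible_countable_Union) auto
  moreover have "{x \<in> space lebesgue. \<not> (x \<in> {0..} \<longrightarrow> (F has_vector_derivative g x) (at x within {0..}))}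
      \<subseteq> insert 0 (\<Union>m. B m)"
  proof
    fix x assume "x \<in> {x \<in> space lebesgue. \<not> (x \<in> {0..} \<longrightarrow> (F has_vector_derivative g x) (at x within {0..}))}"
    then have x: "x \<ge> 0" "\<not> (F has_vector_derivative g x) (at x within {0..})" by auto
    show "x \<in> insert 0 (\<Union>m. B m)"
    proof (rule ccontr)
      assume n: "x \<notin> insert 0 (\<Union>m. B m)"
      obtain m where "x < real (Suc m)" using reals_Archimedean2[of x] by (metis less_Suc_eq of_nat_less_iff less_trans)
      then have "((\<lambda>x. integral {0..x} g) has_vector_derivative g x) (at x)"
        using n x by (auto simp: B_def)
      then have "(F has_vector_derivative g x) (at x)"
        \<comment> \<open>\<open>F\<close> is prescribed only for nonnegative arguments, hence the
          comparison on the open half-line.\<close>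
        by (rule has_vector_derivative_transform_within_open[where S="{0<..}"]) (use n x F in auto)
      then show False using x(2) has_vector_derivative_at_within by blast
    qed
  qed
  ultimately have "AE x in lebesgue. x \<in> {0..} \<longrightarrow> (F has_vector_derivative g x) (at x within {0..})"
    by (intro AE_I') (simp_all add: negligible_iff_null_sets)
  then show "AE x in Rplus. (F has_vector_derivative g x) (at x within {0..})"
    by (subst AE_restrict_space_iff) auto
qed

subsection \<open>Solving the differential equation on a short interval\<close>

text \<open>For \<open>z\<close> = y^(n-1) and zero data at \<open>a\<close>, the
  \<open>k\<close>-fold integral is y^(n-1-k). Working with \<open>z\<close> alone turns the
  equation of order n into one Volterra integral equation.\<close>

primrec iterated_integral :: "real \<Rightarrow> nat \<Rightarrow> (real \<Rightarrow> complex) \<Rightarrow> real \<Rightarrow> complex" where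
  "iterated_integral a 0 z = z"
| "iterated_integral a (Suc k) z = (\<lambda>x. integral {a..x} (iterated_integral a k z))"

lemma continuous_on_iterated_integral:
  assumes "continuous_on {a..b} z"
  shows "continuous_on {a..b} (iterated_integral a k z)"
  by (induction k) (use assms in \<open>auto intro!: indefinite_integral_continuous_1 integrable_continuous_real\<close>)

lemma iterated_integral_integrable:
  assumes "continuous_on {a..b} z" "x \<in> {a..b}"
  shows "iterated_integral a k z integrable_on {a..x}"
  by (rule integrable_continuous_real, rule continuous_on_subset[OF continuous_on_iterated_integral[OF assms(1)]])
     (use assms(2) in auto)

lemma iterated_integral_has_vector_derivative:
  assumes "continuous_on {a..b} z" "x \<in> {a..b}"
  shows "(iterated_integral a (Suc k) z has_vector_derivative iterated_integral a k z x) (at x within {a..b})"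
  using integral_has_vector_derivative[OF continuous_on_iterated_integral[OF assms(1)] assms(2)] by simp

lemma norm_iterated_integral_le:
  assumes "continuous_on {a..b} z" "\<And>x. x \<in> {a..b} \<Longrightarrow> norm (z x) \<le> S" "x \<in> {a..b}"
  shows "norm (iterated_integral a k z x) \<le> (b - a) ^ k * S"
  using assms(3)
proof (induction k arbitrary: x)
  case 0
  then show ?case using assms(2) by simp
next
  case (Suc k)
  have "S \<ge> 0" using assms(2)[OF assms(3)] norm_ge_zero order_trans by blast
  have "norm (iterated_integral a (Suc k) z x) \<le> integral {a..x} (\<lambda>_. (b - a) ^ k * S)"
    unfolding iterated_integral.simps
    by (rule integral_norm_bound_integral)
       (use Suc iterated_integral_integrable[OF assms(1) Suc.prems] in auto)
  also have "\<dots> = (x - a) * ((b - a) ^ k * S)" using Suc.prems by simp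
  also have "\<dots> \<le> (b - a) * ((b - a) ^ k * S)"
    using Suc.prems \<open>S \<ge> 0\<close> by (intro mult_right_mono) auto
  finally show ?case by simp
qed

lemma iterated_integral_sum:
  assumes "finite J" "\<And>i. i \<in> J \<Longrightarrow> continuous_on {a..b} (z i)" "x \<in> {a..b}"
  shows "iterated_integral a k (\<lambda>t. \<Sum>i\<in>J. c i * z i t) x = (\<Sum>i\<in>J. c i * iterated_integral a k (z i) x)"
  using assms(3)
proof (induction k arbitrary: x)
  case (Suc k)
  have "iterated_integral a (Suc k) (\<lambda>t. \<Sum>i\<in>J. c i * z i t) x =
      integral {a..x} (\<lambda>t. \<Sum>i\<in>J. c i * iterated_integral a k (z i) t)"
    unfolding iterated_integral.simps by (rule integral_cong) (use Suc in auto)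
  also have "\<dots> = (\<Sum>i\<in>J. integral {a..x} (\<lambda>t. c i * iterated_integral a k (z i) t))"
    by (rule integral_sum[OF assms(1)])
       (use iterated_integral_integrable[OF assms(2) Suc.prems] in \<open>auto intro!: integrable_on_mult_right\<close>)
  finally show ?case by simp
qed simp

lemma iterated_integral_diff:
  assumes "continuous_on {a..b} z" "continuous_on {a..b} w" "x \<in> {a..b}"
  shows "iterated_integral a k (\<lambda>t. z t - w t) x = iterated_integral a k z x - iterated_integral a k w x"
  using iterated_integral_sum[of "{False, True}" a b "\<lambda>i. if i then z else w" x k "\<lambda>i. if i then 1 else -1"] assms
  by simp

text \<open>The equation \<open>l(y) = f\<close> with zero data at \<open>a\<close> is solved for \<open>z = y\<^sup>(\<^sup>n\<^sup>-\<^sup>1\<^sup>)\<close>; the lower order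
  derivatives are then iterated integrals of \<open>z\<close>. The factor \<open>b - a\<close> in front of the coefficients
  with \<open>j \<ge> 2\<close> comes from these integrations and is what makes \<open>\<kappa>\<close> small on short intervals.\<close>

locale perturbation =
  fixes n :: nat and p :: "nat \<Rightarrow> real \<Rightarrow> complex" and a b \<kappa> :: real
  assumes n: "n \<ge> 1" and ab: "a < b" "b - a \<le> 1"
    and p: "\<And>j. j \<in> {1..n} \<Longrightarrow> p j absolutely_integrable_on {a..b}"
    and \<kappa>: "integral {a..b} (\<lambda>t. cmod (p 1 t) + (b - a) * (\<Sum>j=2..n. cmod (p j t))) \<le> \<kappa>"
    and \<kappa>_small: "\<kappa> \<le> 1 / 2"
begin

text \<open>For \<open>z\<close> = y^(n-1) the factor \<open>iterated_integral a (j - 1) z\<close>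
  is y^(n-j), so this is the part of l(y) below order n.\<close>

definition lower_terms :: "(real \<Rightarrow> complex) \<Rightarrow> real \<Rightarrow> complex" where
  "lower_terms z t = (\<Sum>j=1..n. p j t * iterated_integral a (j - 1) z t)"

lemma norm_p_integrable:
  "j \<in> {1..n} \<Longrightarrow> (\<lambda>t. cmod (p j t)) integrable_on {a..b}"
  using p absolutely_integrable_on_def by blast

lemma weight_integrable:
  "(\<lambda>t. cmod (p 1 t) + (b - a) * (\<Sum>j=2..n. cmod (p j t))) integrable_on {a..b}"
  using n by (intro integrable_add integrable_on_mult_right integrable_sum norm_p_integrable) auto

lemma weight_nonneg: "0 \<le> cmod (p 1 t) + (b - a) * (\<Sum>j=2..n. cmod (p j t))"
  using ab by (auto intro!: add_nonneg_nonneg mult_nonneg_nonneg sum_nonneg)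

lemma lower_terms_absolutely_integrable:
  assumes "continuous_on {a..b} z"
  shows "lower_terms z absolutely_integrable_on {a..b}"
proof -
  have "(\<lambda>t. p j t * iterated_integral a (j - 1) z t) absolutely_integrable_on {a..b}" if "j \<in> {1..n}" for j
  proof -
    have c: "continuous_on {a..b} (iterated_integral a (j - 1) z)"
      by (rule continuous_on_iterated_integral[OF assms])
    have "(\<lambda>t. iterated_integral a (j - 1) z t * p j t) absolutely_integrable_on {a..b}"
      by (rule absolutely_integrable_bounded_measurable_product[OF bilinear_times])
         (use c p[OF that] in \<open>auto intro: continuous_imp_measurable_on_sets_lebesgue compact_imp_bounded compact_continuous_image\<close>)
    then show ?thesis by (simp add: mult.commute)
  qed
  then show ?thesis unfolding lower_terms_def
    by (intro absolutely_integrable_sum) auto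
qed

text \<open>The term \<open>j = 1\<close> involves no integration and gets no small factor. For
  \<open>j \<ge> 2\<close> there is at least one integration, and higher powers of
  \<open>b - a\<close> are at most \<open>b - a\<close> since \<open>b - a \<le> 1\<close>.\<close>

lemma norm_lower_terms_le:
  assumes "continuous_on {a..b} z" "\<And>x. x \<in> {a..b} \<Longrightarrow> norm (z x) \<le> S" "t \<in> {a..b}"
  shows "norm (lower_terms z t) \<le> (cmod (p 1 t) + (b - a) * (\<Sum>j=2..n. cmod (p j t))) * S"
proof -
  have S: "S \<ge> 0" using assms(2)[OF assms(3)] norm_ge_zero order_trans by blast
  have pow: "(b - a) ^ k \<le> b - a" if "k \<ge> 1" for k
    using power_decreasing[of 1 k "b - a"] that ab by simp
  have "norm (lower_terms z t) \<le> (\<Sum>j=1..n. cmod (p j t) * ((b - a) ^ (j - 1) * S))"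
    unfolding lower_terms_def
    by (rule order_trans[OF norm_sum], intro sum_mono)
       (auto simp: norm_mult intro!: mult_left_mono norm_iterated_integral_le assms(1,3) assms(2))
  also have "\<dots> = cmod (p 1 t) * S + (\<Sum>j=2..n. cmod (p j t) * ((b - a) ^ (j - 1) * S))"
    using n by (subst sum.atLeast_Suc_atMost) (auto simp: numeral_2_eq_2)
  also have "(\<Sum>j=2..n. cmod (p j t) * ((b - a) ^ (j - 1) * S)) \<le> (\<Sum>j=2..n. cmod (p j t) * ((b - a) * S))"
    using S by (intro sum_mono mult_left_mono mult_right_mono pow) auto
  finally show ?thesis by (simp add: algebra_simps sum_distrib_left sum_distrib_right)
qed

text \<open>The constant \<kappa> bounds the integral operator in the supremum norm. This gives the
  contraction, the a priori bound and the error term of the lower bound.\<close>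

lemma norm_integral_lower_terms_le:
  assumes "continuous_on {a..b} z" "\<And>x. x \<in> {a..b} \<Longrightarrow> norm (z x) \<le> S"
    and uv: "a \<le> u" "u \<le> v" "v \<le> b"
  shows "norm (integral {u..v} (lower_terms z)) \<le> \<kappa> * S"
proof -
  let ?w = "\<lambda>t. cmod (p 1 t) + (b - a) * (\<Sum>j=2..n. cmod (p j t))"
  have S: "S \<ge> 0" using assms(2)[of a] ab order_trans[OF norm_ge_zero] by simp
  have wab: "(\<lambda>t. ?w t * S) integrable_on {a..b}"
    by (rule integrable_on_mult_left[OF weight_integrable])
  then have wi: "(\<lambda>t. ?w t * S) integrable_on {u..v}"
    by (rule integrable_on_subinterval) (use uv in auto)
  have "norm (integral {u..v} (lower_terms z)) \<le> integral {u..v} (\<lambda>t. ?w t * S)"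
  proof (rule integral_norm_bound_integral)
    show "lower_terms z integrable_on {u..v}"
      using integrable_on_subinterval[OF set_lebesgue_integral_eq_integral(1)[OF lower_terms_absolutely_integrable[OF assms(1)]]] uv
      by auto
  qed (use uv wi norm_lower_terms_le[OF assms(1,2)] in auto)
  also have "\<dots> \<le> integral {a..b} (\<lambda>t. ?w t * S)"
    by (rule integral_subset_le)
       (use uv wi wab mult_nonneg_nonneg[OF weight_nonneg S] in auto)
  also have "\<dots> = integral {a..b} ?w * S" by simp
  also have "\<dots> \<le> \<kappa> * S" using \<kappa> S by (rule mult_right_mono)
  finally show ?thesis .
qed

lemma lower_terms_diff:
  assumes "continuous_on {a..b} z" "continuous_on {a..b} w" "t \<in> {a..b}"
  shows "lower_terms (\<lambda>x. z x - w x) t = lower_terms z t - lower_terms w t"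
  unfolding lower_terms_def by (simp add: iterated_integral_diff[OF assms] algebra_simps sum_subtractf)

lemma lower_terms_sum:
  assumes "finite J" "\<And>i. i \<in> J \<Longrightarrow> continuous_on {a..b} (z i)" "t \<in> {a..b}"
  shows "lower_terms (\<lambda>t. \<Sum>i\<in>J. c i * z i t) t = (\<Sum>i\<in>J. c i * lower_terms (z i) t)"
proof -
  have "lower_terms (\<lambda>t. \<Sum>i\<in>J. c i * z i t) t =
     (\<Sum>j=1..n. \<Sum>i\<in>J. c i * (p j t * iterated_integral a (j - 1) (z i) t))"
    unfolding lower_terms_def
    by (intro sum.cong refl) (simp only: iterated_integral_sum[OF assms] sum_distrib_left mult.left_commute)
  also have "\<dots> = (\<Sum>i\<in>J. c i * lower_terms (z i) t)"
    unfolding lower_terms_def sum_distrib_left by (rule sum.swap)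
  finally show ?thesis .
qed

text \<open>The integral form of l(y) = f includes the zero value of \<open>z\<close> at
  \<open>a\<close> and avoids a pointwise demand on y^(n), which exists only almost
  everywhere.\<close>

definition is_solution :: "(real \<Rightarrow> complex) \<Rightarrow> (real \<Rightarrow> complex) \<Rightarrow> bool" where
  "is_solution f z \<longleftrightarrow> continuous_on {a..b} z \<and>
     (\<forall>x\<in>{a..b}. z x = integral {a..x} (\<lambda>t. f t - lower_terms z t))"

lemma rhs_integrable:
  assumes "f absolutely_integrable_on {a..b}" "continuous_on {a..b} z" "a \<le> u" "v \<le> b"
  shows "(\<lambda>t. f t - lower_terms z t) integrable_on {u..v}"
  by (rule integrable_on_subinterval[where S="{a..b}"])
     (use assms in \<open>auto intro!: set_lebesgue_integral_eq_integral(1) set_integral_diff(1) lower_terms_absolutely_integrable\<close>)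

text \<open>Banach's fixed point theorem for the integral equation; the contraction factor is at
  most 1/2 because \<open>\<kappa> \<le> 1 / 2\<close>.\<close>

lemma solution_exists:
  assumes f: "f absolutely_integrable_on {a..b}"
  obtains z where "is_solution f z"
proof -
  define T where "T = (\<lambda>z x. integral {a..x} (\<lambda>t. f t - lower_terms z t))"
  have T_cont: "continuous_on {a..b} (T z)" if "continuous_on {a..b} z" for z
    unfolding T_def by (intro indefinite_integral_continuous_1 rhs_integrable f that) auto
  \<comment> \<open>Composition with \<open>clamp\<close> extends functions on {a..b} by constants,
    so that the complete space of bounded continuous functions on the line can be used.\<close>
  have "\<exists>g :: real \<Rightarrow>\<^sub>C complex. \<forall>x. apply_bcontfun g x = T (apply_bcontfun z) (clamp a b x)" for z :: "real \<Rightarrow>\<^sub>C complex"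
    using continuous_on_cbox_bcontfunE[of a b "T (apply_bcontfun z)"] T_cont[of "apply_bcontfun z"] by auto
  then obtain \<Phi> :: "(real \<Rightarrow>\<^sub>C complex) \<Rightarrow> (real \<Rightarrow>\<^sub>C complex)"
    where \<Phi>: "\<And>z x. apply_bcontfun (\<Phi> z) x = T (apply_bcontfun z) (clamp a b x)"
    by metis
  have contr: "dist (\<Phi> z) (\<Phi> w) \<le> 1 / 2 * dist z w" for z w
  proof (rule dist_bound)
    fix x
    let ?x = "clamp a b x"
    let ?d = "\<lambda>t. apply_bcontfun z t - apply_bcontfun w t"
    have x: "?x \<in> {a..b}" using clamp_in_interval[of a b x] ab by simp
    have "T (apply_bcontfun z) ?x - T (apply_bcontfun w) ?x =
        integral {a..?x} (\<lambda>t. (f t - lower_terms (apply_bcontfun z) t) - (f t - lower_terms (apply_bcontfun w) t))"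
      unfolding T_def by (rule Henstock_Kurzweil_Integration.integral_diff[symmetric])
        (use x in \<open>auto intro!: rhs_integrable f\<close>)
    also have "\<dots> = integral {a..?x} (\<lambda>t. - lower_terms ?d t)"
      by (rule integral_cong) (use x in \<open>auto simp: lower_terms_diff\<close>)
    finally have "norm (T (apply_bcontfun z) ?x - T (apply_bcontfun w) ?x) = norm (integral {a..?x} (lower_terms ?d))"
      by (simp add: norm_minus_commute)
    also have "\<dots> \<le> \<kappa> * dist z w"
      by (rule norm_integral_lower_terms_le)
         (use x dist_bounded[of z _ w] in \<open>auto intro!: continuous_intros simp: dist_norm\<close>)
    also have "\<dots> \<le> 1 / 2 * dist z w" using \<kappa>_small by (intro mult_right_mono) auto
    finally show "dist (apply_bcontfun (\<Phi> z) x) (apply_bcontfun (\<Phi> w) x) \<le> 1 / 2 * dist z w"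
      unfolding \<Phi> dist_norm .
  qed
  obtain z where z: "\<Phi> z = z"
    using banach_fix_type[of "1/2" \<Phi>] contr by auto
  have "apply_bcontfun z x = T (apply_bcontfun z) x" if "x \<in> {a..b}" for x
    using \<Phi>[of z x] that by (simp add: z)
  then have "is_solution f (apply_bcontfun z)"
    unfolding is_solution_def T_def by auto
  then show ?thesis by (rule that)
qed

lemma solution_sum:
  assumes "finite J" "\<And>i. i \<in> J \<Longrightarrow> f i absolutely_integrable_on {a..b}"
    and z: "\<And>i. i \<in> J \<Longrightarrow> is_solution (f i) (z i)"
  shows "is_solution (\<lambda>t. \<Sum>i\<in>J. c i * f i t) (\<lambda>t. \<Sum>i\<in>J. c i * z i t)"
  unfolding is_solution_def
proof (intro conjI ballI)
  have zc: "continuous_on {a..b} (z i)" if "i \<in> J" for i using z that by (auto simp: is_solution_def)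
  show "continuous_on {a..b} (\<lambda>t. \<Sum>i\<in>J. c i * z i t)"
    by (intro continuous_intros zc)
  fix x assume x: "x \<in> {a..b}"
  have "(\<Sum>i\<in>J. c i * z i x) = (\<Sum>i\<in>J. integral {a..x} (\<lambda>t. c i * (f i t - lower_terms (z i) t)))"
    using z x by (intro sum.cong refl) (simp add: is_solution_def)
  also have "\<dots> = integral {a..x} (\<lambda>t. \<Sum>i\<in>J. c i * (f i t - lower_terms (z i) t))"
    by (rule integral_sum[symmetric]) (use x assms zc in \<open>auto intro!: integrable_on_mult_right rhs_integrable\<close>)
  also have "\<dots> = integral {a..x} (\<lambda>t. (\<Sum>i\<in>J. c i * f i t) - lower_terms (\<lambda>t. \<Sum>i\<in>J. c i * z i t) t)"
    by (rule integral_cong)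
       (use x zc assms(1) in \<open>auto simp: lower_terms_sum right_diff_distrib sum_subtractf\<close>)
  finally show "(\<Sum>i\<in>J. c i * z i x) = \<dots>" .
qed

text \<open>At a maximum point of the modulus of \<open>z\<close> the lower order terms contribute
  at most half of the maximum and are absorbed.\<close>

lemma solution_bound:
  assumes f: "f absolutely_integrable_on {a..b}" "\<And>t. t \<in> {a..b} \<Longrightarrow> norm (f t) \<le> 1"
    and z: "is_solution f z" and x: "x \<in> {a..b}"
  shows "norm (z x) \<le> 2 * (b - a)"
proof -
  have zc: "continuous_on {a..b} z" using z by (simp add: is_solution_def)
  obtain x0 where x0: "x0 \<in> {a..b}" "\<And>y. y \<in> {a..b} \<Longrightarrow> norm (z y) \<le> norm (z x0)"
    using continuous_attains_sup[OF compact_Icc _ continuous_on_norm[OF zc]] ab by auto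
  have fi: "f integrable_on {a..x0}"
    by (rule integrable_on_subinterval[where S="{a..b}"])
       (use f x0 in \<open>auto intro: set_lebesgue_integral_eq_integral(1)\<close>)
  have li: "lower_terms z integrable_on {a..x0}"
    by (rule integrable_on_subinterval[where S="{a..b}"])
       (use x0 lower_terms_absolutely_integrable[OF zc] in \<open>auto intro: set_lebesgue_integral_eq_integral(1)\<close>)
  have "z x0 = integral {a..x0} f - integral {a..x0} (lower_terms z)"
    using z x0(1) fi li by (simp add: is_solution_def Henstock_Kurzweil_Integration.integral_diff)
  then have "norm (z x0) \<le> norm (integral {a..x0} f) + norm (integral {a..x0} (lower_terms z))"
    using norm_triangle_ineq4 by metis
  also have "norm (integral {a..x0} f) \<le> integral {a..x0} (\<lambda>_. 1)"
    by (rule integral_norm_bound_integral) (use fi f x0 in auto)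
  also have "\<dots> \<le> b - a" using x0 by simp
  also have "norm (integral {a..x0} (lower_terms z)) \<le> \<kappa> * norm (z x0)"
    by (rule norm_integral_lower_terms_le[OF zc x0(2)]) (use x0 in auto)
  also have "\<dots> \<le> 1 / 2 * norm (z x0)" using \<kappa>_small by (rule mult_right_mono) simp
  finally have "norm (z x0) \<le> 2 * (b - a)" by simp
  then show ?thesis using x0(2)[OF x] by simp
qed

end

subsection \<open>Compactly supported functions in the minimal domain\<close>

text \<open>With zero total integral the primitive returns to zero at \<open>b\<close>, so its
  extension by zero is the primitive of the extension. This carries the relation between successive
  derivatives over to the half-line.\<close>

lemma integral_cutoff:
  fixes H :: "real \<Rightarrow> complex"
  assumes "0 \<le> a" "a \<le> b" "0 \<le> x" "integral {a..b} H = 0"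
  shows "integral {0..x} (\<lambda>t. if t \<in> {a..b} then H t else 0) = (if x \<in> {a..b} then integral {a..x} H else 0)"
proof -
  have "integral {0..x} (\<lambda>t. if t \<in> {a..b} then H t else 0) = integral ({a..b} \<inter> {0..x}) H"
    by (rule integral_restrict_Int)
  moreover have "{a..b} \<inter> {0..x} = {a..x}" if "x \<le> b" using that assms by auto
  moreover have "{a..b} \<inter> {0..x} = {a..b}" if "x > b" using that assms by auto
  moreover have "integral {a..x} H = 0" if "x < a" using that by simp
  ultimately show ?thesis using assms by (cases "x \<le> b") auto
qed

lemma L2_bounded_support:
  assumes f: "f \<in> borel_measurable lebesgue" and "0 \<le> a" "a \<le> b"
    and bd: "\<And>x. cmod (f x) \<le> B * indicator {a..b} x"
  shows "L2 f" and "(\<integral>x. (cmod (f x))\<^sup>2 \<partial>Rplus) \<le> B\<^sup>2 * (b - a)"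
proof -
  have fm: "f \<in> borel_measurable Rplus" by (rule measurable_restrict_space1[OF f])
  have sq: "(cmod (f x))\<^sup>2 \<le> B\<^sup>2 * indicator {a..b} x" for x
    using power_mono[OF bd[of x], of 2] by (cases "x \<in> {a..b}") auto
  have em: "emeasure Rplus {a..b} = ennreal (b - a)"
    using assms by (subst emeasure_restrict_space) auto
  have ind: "integrable Rplus (\<lambda>x. B\<^sup>2 * indicator {a..b} x :: real)"
    using assms em by (intro integrable_mult_right integrable_real_indicator) (auto simp: sets_restrict_space_iff)
  have int: "integrable Rplus (\<lambda>x. (cmod (f x))\<^sup>2)"
    by (rule Bochner_Integration.integrable_bound[OF ind]) (use fm sq in auto)
  then show "L2 f" using fm by (simp add: L2_def)
  have "(\<integral>x. (cmod (f x))\<^sup>2 \<partial>Rplus) \<le> (\<integral>x. B\<^sup>2 * indicator {a..b} x \<partial>Rplus)"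
    by (rule integral_mono[OF int ind sq])
  also have "\<dots> = B\<^sup>2 * measure Rplus {a..b}"
    using assms by (simp add: sets_restrict_space_iff)
  also have "\<dots> = B\<^sup>2 * (b - a)" using assms em by (simp add: measure_def)
  finally show "(\<integral>x. (cmod (f x))\<^sup>2 \<partial>Rplus) \<le> B\<^sup>2 * (b - a)" .
qed

section \<open>Steering with step functions, and the resulting bump functions\<close>

context perturbation
begin

definition piece_length :: real where
  "piece_length = (b - a) / (real n + 1)"

text \<open>Half-open, so that distinct pieces are disjoint; the point \<open>b\<close> belongs to
  no piece with index at most \<open>n\<close>.\<close>

definition piece :: "nat \<Rightarrow> real set" where
  "piece i = {a + real i * piece_length..<a + (real i + 1) * piece_length}"

text \<open>Control functions are step functions with one more coefficient than there are boundary
  conditions at \<^term>\<open>b\<close>, so some nonzero one steers the zero initial state back to zero.\<close>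

definition control :: "(nat \<Rightarrow> complex) \<Rightarrow> real \<Rightarrow> complex" where
  "control c t = (\<Sum>i\<le>n. c i * indicator (piece i) t)"

lemma piece_length_pos: "piece_length > 0"
  using ab by (simp add: piece_length_def)

lemma piece_subset:
  assumes "i \<le> n"
  shows "{a + real i * piece_length..a + (real i + 1) * piece_length} \<subseteq> {a..b}"
proof -
  have "(real i + 1) * piece_length \<le> (real n + 1) * piece_length"
    using assms piece_length_pos by (intro mult_right_mono) auto
  also have "\<dots> = b - a" by (simp add: piece_length_def)
  finally show ?thesis using piece_length_pos by auto
qed

lemma piece_disjoint:
  assumes "t \<in> piece i" "t \<in> piece j"
  shows "i = j"
proof -
  have "\<not> i < j" if "t \<in> piece i" "t \<in> piece j" for i j
  proof
    assume "i < j"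
    then have "(real i + 1) * piece_length \<le> real j * piece_length"
      using piece_length_pos by (intro mult_right_mono) auto
    then show False using that by (auto simp: piece_def)
  qed
  then show ?thesis using assms by (meson linorder_neqE_nat)
qed

lemma control_eq:
  assumes "t \<in> piece i" "i \<le> n"
  shows "control c t = c i"
proof -
  have "control c t = (\<Sum>j\<le>n. if j = i then c i else 0)"
    unfolding control_def using assms piece_disjoint by (intro sum.cong) (auto simp: indicator_def)
  then show ?thesis using assms by simp
qed

lemma norm_control_le:
  assumes "\<And>i. i \<le> n \<Longrightarrow> norm (c i) \<le> 1"
  shows "norm (control c t) \<le> 1"
proof (cases "\<exists>i\<le>n. t \<in> piece i")
  case True
  then show ?thesis using control_eq assms by auto
next
  case False
  then have "control c t = 0" unfolding control_def by (intro sum.neutral) auto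
  then show ?thesis by simp
qed

lemma control_measurable: "control c \<in> borel_measurable lebesgue"
  unfolding control_def piece_def by (intro borel_measurable_sum borel_measurable_times borel_measurable_indicator) auto

lemma control_absolutely_integrable: "control c absolutely_integrable_on {a..b}"
proof (rule measurable_bounded_by_integrable_imp_absolutely_integrable)
  show "control c \<in> borel_measurable (lebesgue_on {a..b})"
    by (rule measurable_restrict_space1[OF control_measurable])
  show "norm (control c t) \<le> (\<Sum>i\<le>n. norm (c i))" for t
    unfolding control_def by (rule order_trans[OF norm_sum]) (auto intro!: sum_mono simp: norm_mult indicator_def)
qed auto

text \<open>By linearity the \<open>n\<close> end conditions are homogeneous linear equations in the
  \<open>n + 1\<close> step coefficients, and a nontrivial solution can be divided by its largest
  modulus.\<close>

lemma controlled_solution_exists: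
  obtains i c z where "i \<le> n" "norm (c i) = 1" "\<forall>j\<le>n. norm (c j) \<le> 1"
    "is_solution (control c) z" "\<forall>k<n. iterated_integral a k z b = 0"
proof -
  let ?e = "\<lambda>i t. indicator (piece i) t :: complex"
  have e: "?e i absolutely_integrable_on {a..b}" if "i \<in> {..n}" for i
  proof -
    have "control (\<lambda>j. if j = i then 1 else 0) = ?e i"
      using that by (auto simp: control_def if_distrib[of "\<lambda>x. x * _"] cong: if_cong)
    then show ?thesis using control_absolutely_integrable by metis
  qed
  have "\<forall>i\<in>{..n}. \<exists>w. is_solution (?e i) w"
    using solution_exists e by metis
  then obtain w where w: "\<And>i. i \<in> {..n} \<Longrightarrow> is_solution (?e i) (w i)" by metis
  have wc: "continuous_on {a..b} (w i)" if "i \<in> {..n}" for i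
    using w[OF that] by (simp add: is_solution_def)
  obtain c' where c': "\<exists>i\<in>{..n}. c' i \<noteq> 0"
    "\<And>k. k \<in> {..<n} \<Longrightarrow> (\<Sum>i\<in>{..n}. c' i * iterated_integral a k (w i) b) = 0"
    using homogeneous_system_nontrivial_solution[of "{..<n}" "{..n}" "\<lambda>k i. iterated_integral a k (w i) b"] by auto
  define N where "N = Max ((\<lambda>i. norm (c' i)) ` {..n})"
  have N_ge: "norm (c' j) \<le> N" if "j \<le> n" for j
    unfolding N_def using that by (intro Max_ge) auto
  have "N \<in> (\<lambda>i. norm (c' i)) ` {..n}" unfolding N_def by (intro Max_in) auto
  then obtain i where i: "i \<le> n" "norm (c' i) = N" by auto
  obtain j where "j \<le> n" "c' j \<noteq> 0" using c'(1) by auto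
  then have N: "N > 0" using N_ge[of j] by (auto intro: less_le_trans[of 0 "norm (c' j)"])
  define c where "c = (\<lambda>j. c' j / of_real N)"
  define z where "z = (\<lambda>t. \<Sum>i\<in>{..n}. c i * w i t)"
  show thesis
  proof
    show "i \<le> n" by (rule i)
    show "norm (c i) = 1" using i N by (simp add: c_def norm_divide)
    show "\<forall>j\<le>n. norm (c j) \<le> 1" using N_ge N by (simp add: c_def norm_divide)
    show "is_solution (control c) z"
      unfolding control_def[abs_def] z_def by (rule solution_sum) (use e w in auto)
    show "\<forall>k<n. iterated_integral a k z b = 0"
    proof (intro allI impI)
      fix k assume "k < n"
      have "iterated_integral a k z b = (\<Sum>i\<in>{..n}. c i * iterated_integral a k (w i) b)"
        unfolding z_def by (rule iterated_integral_sum) (use wc ab in auto)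
      also have "\<dots> = (\<Sum>i\<in>{..n}. c' i * iterated_integral a k (w i) b) / of_real N"
        by (simp add: c_def sum_divide_distrib)
      also have "\<dots> = 0" using c'(2) \<open>k < n\<close> by simp
      finally show "iterated_integral a k z b = 0" .
    qed
  qed
qed

text \<open>The finite-difference step: \<open>n\<close> steps exactly fill one piece.\<close>

definition step :: real where
  "step = (b - a) / (real n * (real n + 1))"

lemma step_pos: "step > 0"
  using ab n by (simp add: step_def)

text \<open>On piece \<open>i\<close> the control is the constant \<open>c i\<close> of modulus one.
  Over one step \<open>z\<close> therefore moves by \<open>step * c i\<close>, up to an error of at
  most \<open>step / 2\<close>; finite differences turn this growth of y^(n-1) into a lower bound
  for y.\<close>

lemma iterated_solution_lower_bound:
  assumes \<kappa>': "\<kappa> \<le> 1 / (4 * real n * (real n + 1))"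
    and i: "i \<le> n" "norm (c i) = 1" and c: "\<And>j. j \<le> n \<Longrightarrow> norm (c j) \<le> 1"
    and z: "is_solution (control c) z"
  shows "\<exists>x\<in>{a..b}. step ^ n / 2 ^ (n + 1) \<le> norm (iterated_integral a (n - 1) z x)"
proof -
  define m where "m = n - 1"
  have nm: "n = Suc m" using n by (simp add: m_def)
  define \<alpha> where "\<alpha> = a + real i * piece_length"
  have len: "(real m + 1) * step = piece_length"
    using n by (simp add: m_def of_nat_diff step_def piece_length_def)
  have sub: "{\<alpha>..\<alpha> + (real m + 1) * step} \<subseteq> {a..b}"
    using piece_subset[OF i(1)] unfolding len \<alpha>_def by (simp add: algebra_simps)
  have zc: "continuous_on {a..b} z" using z by (simp add: is_solution_def)
  \<comment> \<open>\<open>\<phi> k\<close> is the real part of y^(k) after a rotation that makes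
    the driving term \<open>c i\<close> equal to 1; \<open>\<phi> 0\<close> comes from y and
    \<open>\<phi> m\<close> from \<open>z\<close>.\<close>
  define \<phi> where "\<phi> = (\<lambda>k x. Re (cnj (c i) * iterated_integral a (m - k) z x))"
  have "\<exists>x\<in>{\<alpha>..\<alpha> + (real m + 1) * step}. \<bar>\<phi> 0 x\<bar> \<ge> step ^ m * (step / 2) / 2 ^ (m + 1)"
  proof (rule finite_difference_lower_bound[OF step_pos])
    fix k x assume k: "k < m" and x: "x \<in> {\<alpha>..\<alpha> + (real m + 1) * step}"
    have "(iterated_integral a (Suc (m - Suc k)) z has_vector_derivative iterated_integral a (m - Suc k) z x) (at x within {a..b})"
      by (rule iterated_integral_has_vector_derivative[OF zc]) (use x sub in auto)
    then have "(iterated_integral a (m - k) z has_vector_derivative iterated_integral a (m - Suc k) z x)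
        (at x within {\<alpha>..\<alpha> + (real m + 1) * step})"
      using k has_vector_derivative_within_subset[OF _ sub] by (simp add: Suc_diff_Suc)
    then have "(\<phi> k has_vector_derivative \<phi> (Suc k) x) (at x within {\<alpha>..\<alpha> + (real m + 1) * step})"
      unfolding \<phi>_def
      by (intro bounded_linear.has_vector_derivative[OF bounded_linear_Re]
          bounded_linear.has_vector_derivative[OF bounded_linear_mult_right])
    then show "(\<phi> k has_real_derivative \<phi> (Suc k) x) (at x within {\<alpha>..\<alpha> + (real m + 1) * step})"
      by (simp add: has_real_derivative_iff_has_vector_derivative)
  next
    fix x assume x: "x \<in> {\<alpha>..\<alpha> + real m * step}"
    let ?y = "x + step"
    have y: "?y \<le> \<alpha> + (real m + 1) * step" using x by (simp add: algebra_simps)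
    have xy: "a \<le> x" "x \<le> ?y" "?y \<le> b" using x y sub step_pos by auto
    have ci: "control c integrable_on {x..?y}"
      by (rule integrable_on_subinterval[where S="{a..b}"])
         (use xy control_absolutely_integrable in \<open>auto intro: set_lebesgue_integral_eq_integral(1)\<close>)
    have li: "lower_terms z integrable_on {x..?y}"
      by (rule integrable_on_subinterval[where S="{a..b}"])
         (use xy lower_terms_absolutely_integrable[OF zc] in \<open>auto intro: set_lebesgue_integral_eq_integral(1)\<close>)
    have "integral {a..x} (\<lambda>t. control c t - lower_terms z t) + integral {x..?y} (\<lambda>t. control c t - lower_terms z t)
        = integral {a..?y} (\<lambda>t. control c t - lower_terms z t)"
      using xy by (intro Henstock_Kurzweil_Integration.integral_combine rhs_integrable control_absolutely_integrable zc) auto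
    then have "z ?y - z x = integral {x..?y} (\<lambda>t. control c t - lower_terms z t)"
      using z xy unfolding is_solution_def by (auto simp: algebra_simps)
    also have "\<dots> = integral {x..?y} (control c) - integral {x..?y} (lower_terms z)"
      by (rule Henstock_Kurzweil_Integration.integral_diff[OF ci li])
    \<comment> \<open>The step may end at the right end of the piece, which the half-open piece
      excludes; the open interval avoids it.\<close>
    also have "integral {x..?y} (control c) = integral {x<..<?y} (\<lambda>_. c i)"
      unfolding integral_open_interval_real
    proof (rule integral_cong)
      fix t assume "t \<in> {x<..<?y}"
      then have "t \<in> piece i"
        using x y unfolding len by (auto simp: piece_def \<alpha>_def algebra_simps)
      then show "control c t = c i" using i(1) by (rule control_eq)
    qed
    also have "\<dots> = of_real step * c i"
      unfolding integral_open_interval_real[symmetric] using step_pos by (simp add: scaleR_conv_of_real)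
    finally have "z ?y - z x = of_real step * c i - integral {x..?y} (lower_terms z)" .
    then have "cnj (c i) * (z ?y - z x) = of_real step * (c i * cnj (c i)) - cnj (c i) * integral {x..?y} (lower_terms z)"
      by (simp only:) (simp add: algebra_simps)
    also have "c i * cnj (c i) = 1"
      using i(2) by (simp add: complex_norm_square[symmetric])
    finally have "Re (cnj (c i) * (z ?y - z x)) = step - Re (cnj (c i) * integral {x..?y} (lower_terms z))"
      by simp
    moreover have "Re (cnj (c i) * integral {x..?y} (lower_terms z)) \<le> norm (cnj (c i) * integral {x..?y} (lower_terms z))"
      by (rule complex_Re_le_cmod)
    moreover have "norm (cnj (c i) * integral {x..?y} (lower_terms z)) \<le> \<kappa> * (2 * (b - a))"
      using norm_integral_lower_terms_le[OF zc solution_bound[OF control_absolutely_integrable norm_control_le[OF c] z] xy] i(2)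
      by (simp add: norm_mult)
    \<comment> \<open>The threshold on \<kappa> is chosen to make this error bound exactly half a
      step.\<close>
    moreover have "\<kappa> * (2 * (b - a)) \<le> 1 / (4 * real n * (real n + 1)) * (2 * (b - a))"
      using \<kappa>' ab by (intro mult_right_mono) auto
    moreover have "1 / (4 * real n * (real n + 1)) * (2 * (b - a)) = step / 2"
    proof -
      have "1 / (4 * u * v) * (2 * w) = w / (u * v) / 2" if "u \<noteq> 0" "v \<noteq> 0" for u v w :: real
        using that by (simp add: divide_simps)
      then show ?thesis unfolding step_def using n by (metis add_pos_pos less_irrefl of_nat_0_less_iff less_le_trans zero_less_one)
    qed
    ultimately have "Re (cnj (c i) * (z ?y - z x)) \<ge> step / 2" by linarith
    then show "\<phi> m ?y - \<phi> m x \<ge> step / 2" by (simp add: \<phi>_def algebra_simps)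
  qed
  then obtain x where x: "x \<in> {a..b}" "\<bar>\<phi> 0 x\<bar> \<ge> step ^ m * (step / 2) / 2 ^ (m + 1)" using sub by blast
  have "\<bar>\<phi> 0 x\<bar> \<le> norm (cnj (c i) * iterated_integral a m z x)"
    unfolding \<phi>_def diff_zero by (rule abs_Re_le_cmod)
  also have "\<dots> = norm (iterated_integral a m z x)" using i(2) by (simp add: norm_mult)
  finally have "\<bar>\<phi> 0 x\<bar> \<le> norm (iterated_integral a (n - 1) z x)" by (simp only: m_def)
  moreover have "u ^ n / 2 ^ (n + 1) = u ^ m * (u / 2) / 2 ^ (m + 1)" for u :: real
    by (simp add: nm)
  ultimately have "step ^ n / 2 ^ (n + 1) \<le> norm (iterated_integral a (n - 1) z x)" using x(2) by (metis order_trans)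
  then show ?thesis using x(1) by blast
qed

text \<open>The steered solution is extended by zero; zero data at both ends keep y, ..., y^(n-1)
  absolutely continuous. If \<sigma> bounds the modulus of y from below at one point, the bound 2 on
  y' keeps it above \<sigma>/2 on an interval of length \<sigma>/4, which gives the square integral
  \<sigma>^3/16.\<close>

lemma bump_exists:
  assumes n2: "n \<ge> 2" and a: "0 \<le> a" and \<kappa>': "\<kappa> \<le> 1 / (4 * real n * (real n + 1))"
  obtains Y where "deriv_family n Y" "\<And>k. k < n \<Longrightarrow> Y k 0 = 0" "\<And>x. x \<notin> {a<..<b} \<Longrightarrow> Y 0 x = 0"
    "L2 (Y 0)" "(\<integral>x. (cmod (Y 0 x))\<^sup>2 \<partial>Rplus) \<le> 4"
    "(step ^ n / 2 ^ (n + 1)) ^ 3 / 16 \<le> (\<integral>x. (cmod (Y 0 x))\<^sup>2 \<partial>Rplus)"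
    "L2 (diff_expr n p Y)" "(\<integral>x. (cmod (diff_expr n p Y x))\<^sup>2 \<partial>Rplus) \<le> 1"
proof -
  obtain i c z where i: "i \<le> n" "norm (c i) = 1" and c_all: "\<forall>j\<le>n. norm (c j) \<le> 1"
    and z: "is_solution (control c) z" and end_all: "\<forall>k<n. iterated_integral a k z b = 0"
    by (rule controlled_solution_exists)
  have c: "norm (c j) \<le> 1" if "j \<le> n" for j using c_all that by blast
  have end0: "iterated_integral a k z b = 0" if "k < n" for k using end_all that by blast
  have zc: "continuous_on {a..b} z" using z by (simp add: is_solution_def)
  have ic: "continuous_on {a..b} (iterated_integral a k z)" for k
    by (rule continuous_on_iterated_integral[OF zc])
  have zb: "norm (z x) \<le> 2 * (b - a)" if "x \<in> {a..b}" for x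
    by (rule solution_bound[OF control_absolutely_integrable norm_control_le[OF c] z that])
  have bound: "norm (iterated_integral a k z x) \<le> 2" if "x \<in> {a..b}" for k x
  proof -
    have "norm (iterated_integral a k z x) \<le> (b - a) ^ k * (2 * (b - a))"
      by (rule norm_iterated_integral_le[OF zc zb that])
    also have "\<dots> \<le> 1 * 2" using ab by (intro mult_mono power_le_one) auto
    finally show ?thesis by simp
  qed
  \<comment> \<open>On {a..b} \<open>H k\<close> is y^(k). For \<open>k = n\<close> the equation
    itself supplies a representative of y^(n).\<close>
  define H where "H = (\<lambda>k. if k < n then iterated_integral a (n - 1 - k) z else (\<lambda>t. control c t - lower_terms z t))"
  define Y where "Y = (\<lambda>k x. if x \<in> {a..b} then H k x else 0)"
  have H_int: "H k x = integral {a..x} (H (Suc k))" if "k < n" "x \<in> {a..b}" for k x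
  proof (cases "Suc k < n")
    case True
    then have "n - 1 - k = Suc (n - 1 - Suc k)" by simp
    then show ?thesis using True that by (simp add: H_def)
  next
    case False
    then have "n - 1 - k = 0" "\<not> Suc k < n" using that by auto
    then show ?thesis using that z by (simp add: H_def is_solution_def)
  qed
  have Hb: "H k b = 0" if "k < n" for k
    using end0[of "n - 1 - k"] that by (simp add: H_def)
  have Ha: "H k a = 0" if "k < n" for k
    using H_int[OF that, of a] ab by simp
  have H_ai: "H k absolutely_integrable_on {a..b}" for k
    by (cases "k < n")
       (simp_all add: H_def absolutely_integrable_continuous_real ic set_integral_diff(1)
        control_absolutely_integrable lower_terms_absolutely_integrable zc)
  have Y_ai: "Y k absolutely_integrable_on {0..B}" for k B
  proof -
    have "Y k absolutely_integrable_on UNIV"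
      unfolding Y_def using H_ai absolutely_integrable_restrict_UNIV by blast
    then show ?thesis by (rule set_integrable_subset) auto
  qed
  have Y_int: "Y k x = integral {0..x} (Y (Suc k))" if "k < n" "0 \<le> x" for k x
  proof -
    have "integral {a..b} (H (Suc k)) = 0" using H_int[of k b] Hb that ab by simp
    then have "integral {0..x} (Y (Suc k)) = (if x \<in> {a..b} then integral {a..x} (H (Suc k)) else 0)"
      unfolding Y_def using integral_cutoff[OF a _ that(2)] ab by simp
    then show ?thesis using H_int[OF that(1)] by (simp add: Y_def)
  qed
  have "deriv_family n Y"
    unfolding deriv_family_def
    using indefinite_integral_AC_loc_AE_derivative[OF Y_ai Y_int] by blast
  have "Y k 0 = 0" if "k < n" for k
    using Y_int[OF that, of 0] by simp
  have Y0: "Y 0 x = 0" if "x \<notin> {a<..<b}" for x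
  proof -
    have "x = a \<or> x = b \<or> x \<notin> {a..b}" using that by auto
    then show ?thesis using Ha[of 0] Hb[of 0] n by (auto simp: Y_def)
  qed
  have Y0_meas: "Y 0 \<in> borel_measurable lebesgue"
    unfolding Y_def using n
    by (intro borel_measurable_if_I) (auto simp: H_def intro!: continuous_imp_measurable_on_sets_lebesgue ic)
  have Y0_le: "cmod (Y 0 x) \<le> 2 * indicator {a..b} x" for x
    using bound n by (auto simp: Y_def H_def)
  note Y0_L2 = L2_bounded_support[OF Y0_meas a less_imp_le[OF ab(1)] Y0_le]
  have "(\<integral>x. (cmod (Y 0 x))\<^sup>2 \<partial>Rplus) \<le> 4"
    using Y0_L2(2) ab by simp
  have "(step ^ n / 2 ^ (n + 1)) ^ 3 / 16 \<le> (\<integral>x. (cmod (Y 0 x))\<^sup>2 \<partial>Rplus)"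
  proof -
    define \<sigma> where "\<sigma> = step ^ n / 2 ^ (n + 1)"
    have \<sigma>: "\<sigma> > 0" using step_pos by (simp add: \<sigma>_def)
    obtain x0 where x0: "x0 \<in> {a..b}" "\<sigma> \<le> norm (H 0 x0)"
      using iterated_solution_lower_bound[OF \<kappa>' i c z] n by (auto simp: \<sigma>_def H_def)
    have lip: "norm (H 0 x0 - H 0 x) \<le> 2 * (x0 - x)" if "a \<le> x" "x \<le> x0" for x
    proof -
      have Hi: "H (Suc 0) integrable_on {u..v}" if "a \<le> u" "v \<le> b" for u v
        by (rule integrable_on_subinterval[OF set_lebesgue_integral_eq_integral(1)[OF H_ai]]) (use that in auto)
      have "integral {a..x} (H (Suc 0)) + integral {x..x0} (H (Suc 0)) = integral {a..x0} (H (Suc 0))"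
        using that x0 by (intro Henstock_Kurzweil_Integration.integral_combine Hi) auto
      then have "H 0 x0 - H 0 x = integral {x..x0} (H (Suc 0))"
        using H_int[of 0 x] H_int[of 0 x0] n that x0 by (simp add: algebra_simps)
      \<comment> \<open>Since \<open>n \<ge> 2\<close>, y' is still an iterated integral of
        \<open>z\<close> and is covered by \<open>bound\<close>.\<close>
      also have "norm \<dots> \<le> integral {x..x0} (\<lambda>_. 2)"
        by (rule integral_norm_bound_integral) (use Hi that x0 bound n2 in \<open>auto simp: H_def\<close>)
      also have "\<dots> = 2 * (x0 - x)" using that by simp
      finally show ?thesis .
    qed
    \<comment> \<open>As y vanishes at \<open>a\<close>, the Lipschitz bound keeps \<open>x0\<close>
      away from \<open>a\<close>, so \<open>J\<close> stays inside {a..b}.\<close>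
    have x0a: "\<sigma> / 2 \<le> x0 - a" using lip[of a] x0 Ha[of 0] n by simp
    define J where "J = {x0 - \<sigma> / 4..x0}"
    have JR: "J \<subseteq> {0..}" "J \<subseteq> {a..b}" using x0a x0 a \<sigma> by (auto simp: J_def)
    have em: "emeasure Rplus J = ennreal (\<sigma> / 4)"
      using JR(1) \<sigma> by (subst emeasure_restrict_space) (auto simp: J_def)
    have JS: "J \<in> sets Rplus" using JR(1) by (auto simp: sets_restrict_space_iff J_def)
    have ge: "(\<sigma> / 2)\<^sup>2 * indicator J x \<le> (cmod (Y 0 x))\<^sup>2" for x
    proof (cases "x \<in> J")
      case True
      then have x: "a \<le> x" "x \<le> x0" "x0 - x \<le> \<sigma> / 4" using JR by (auto simp: J_def)
      have "norm (H 0 x0) \<le> norm (H 0 x) + norm (H 0 x0 - H 0 x)" by (rule norm_triangle_sub)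
      with lip[OF x(1,2)] x(3) x0(2) have "\<sigma> - \<sigma> / 2 \<le> norm (H 0 x)" by argo
      then have "\<sigma> / 2 \<le> norm (H 0 x)" by simp
      then have "\<sigma> / 2 \<le> norm (Y 0 x)" using True JR by (auto simp: Y_def)
      then show ?thesis using True \<sigma> by (auto intro!: power_mono)
    qed simp
    have "(\<sigma> / 2)\<^sup>2 * measure Rplus J = (\<integral>x. (\<sigma> / 2)\<^sup>2 * indicator J x \<partial>Rplus)"
      using JS sets.sets_into_space[OF JS] by (simp add: Int_absorb1 Int_absorb2)
    also have "\<dots> \<le> (\<integral>x. (cmod (Y 0 x))\<^sup>2 \<partial>Rplus)"
    proof (rule integral_mono)
      show "integrable Rplus (\<lambda>x. (\<sigma> / 2)\<^sup>2 * indicator J x :: real)"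
        using JS em by (intro integrable_mult_right integrable_real_indicator) auto
      show "integrable Rplus (\<lambda>x. (cmod (Y 0 x))\<^sup>2)" using Y0_L2(1) by (simp add: L2_def)
    qed (rule ge)
    finally show ?thesis unfolding \<sigma>_def[symmetric] using em \<sigma>
      by (simp add: measure_def power2_eq_square power3_eq_cube)
  qed
  \<comment> \<open>The identity holds at every point, because the chosen representative of y^(n)
    cancels the lower order terms exactly.\<close>
  have diff_expr: "diff_expr n p Y = (\<lambda>x. if x \<in> {a..b} then control c x else 0)"
  proof
    fix x
    show "diff_expr n p Y x = (if x \<in> {a..b} then control c x else 0)"
    proof (cases "x \<in> {a..b}")
      case True
      have "(\<Sum>j=1..n. p j x * Y (n - j) x) = lower_terms z x"
        unfolding lower_terms_def using True by (intro sum.cong) (auto simp: Y_def H_def)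
      then show ?thesis using True by (simp add: diff_expr_def Y_def H_def)
    next
      case False
      then show ?thesis unfolding diff_expr_def Y_def by (simp only: if_False) simp
    qed
  qed
  have d_meas: "diff_expr n p Y \<in> borel_measurable lebesgue"
    unfolding diff_expr by (intro borel_measurable_if_I measurable_restrict_space1 control_measurable) auto
  have d_le: "cmod (diff_expr n p Y x) \<le> 1 * indicator {a..b} x" for x
    unfolding diff_expr using norm_control_le[OF c] by auto
  note d_L2 = L2_bounded_support[OF d_meas a less_imp_le[OF ab(1)] d_le]
  have "(\<integral>x. (cmod (diff_expr n p Y x))\<^sup>2 \<partial>Rplus) \<le> 1"
    using d_L2(2) ab by simp
  show thesis by (rule that) fact+
qed

end

subsection \<open>Non-compactness of functions with disjoint supports\<close>

text \<open>The elementary inequality (s + t)^2 \<le> 2 s^2 + 2 t^2 gives closure under sums and a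
  substitute for the triangle inequality in terms of squared norms.\<close>

lemma L2_add_scaled:
  assumes f: "L2 f" and g: "L2 g"
  shows "L2 (\<lambda>x. f x + c * g x)"
    and "(\<integral>x. (cmod (f x + c * g x))\<^sup>2 \<partial>Rplus)
       \<le> 2 * (\<integral>x. (cmod (f x))\<^sup>2 \<partial>Rplus) + 2 * (cmod c)\<^sup>2 * (\<integral>x. (cmod (g x))\<^sup>2 \<partial>Rplus)"
proof -
  have le: "(cmod (f x + c * g x))\<^sup>2 \<le> 2 * (cmod (f x))\<^sup>2 + 2 * (cmod c)\<^sup>2 * (cmod (g x))\<^sup>2" for x
  proof -
    have "(cmod (f x + c * g x))\<^sup>2 \<le> (cmod (f x) + cmod c * cmod (g x))\<^sup>2"
      using norm_triangle_ineq[of "f x" "c * g x"] by (intro power_mono) (auto simp: norm_mult)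
    also have "\<dots> \<le> 2 * (cmod (f x))\<^sup>2 + 2 * (cmod c * cmod (g x))\<^sup>2"
      using sum_squares_bound[of "cmod (f x)" "cmod c * cmod (g x)"] by (simp add: power2_sum)
    finally show ?thesis by (simp add: power_mult_distrib)
  qed
  have m: "(\<lambda>x. f x + c * g x) \<in> borel_measurable Rplus"
    using f g by (auto simp: L2_def)
  have i: "integrable Rplus (\<lambda>x. 2 * (cmod (f x))\<^sup>2 + 2 * (cmod c)\<^sup>2 * (cmod (g x))\<^sup>2)"
    using f g by (auto simp: L2_def)
  have int: "integrable Rplus (\<lambda>x. (cmod (f x + c * g x))\<^sup>2)"
    by (rule Bochner_Integration.integrable_bound[OF i]) (use m le in \<open>auto intro: order_trans[OF le]\<close>)
  show "L2 (\<lambda>x. f x + c * g x)" using m int by (simp add: L2_def)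
  have "(\<integral>x. (cmod (f x + c * g x))\<^sup>2 \<partial>Rplus)
      \<le> (\<integral>x. 2 * (cmod (f x))\<^sup>2 + 2 * (cmod c)\<^sup>2 * (cmod (g x))\<^sup>2 \<partial>Rplus)"
    by (rule integral_mono[OF int i le])
  also have "\<dots> = 2 * (\<integral>x. (cmod (f x))\<^sup>2 \<partial>Rplus) + 2 * (cmod c)\<^sup>2 * (\<integral>x. (cmod (g x))\<^sup>2 \<partial>Rplus)"
    using f g by (subst Bochner_Integration.integral_add) (auto simp: L2_def)
  finally show "(\<integral>x. (cmod (f x + c * g x))\<^sup>2 \<partial>Rplus)
       \<le> 2 * (\<integral>x. (cmod (f x))\<^sup>2 \<partial>Rplus) + 2 * (cmod c)\<^sup>2 * (\<integral>x. (cmod (g x))\<^sup>2 \<partial>Rplus)" .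
qed

lemma L2_norm_power2: "(L2_norm f)\<^sup>2 = (\<integral>x. (cmod (f x))\<^sup>2 \<partial>Rplus)"
  by (simp add: L2_norm_def)

text \<open>Disjoint supports bound the modulus of \<open>y i\<close> by that of the difference of
  two consecutive members. If both are close to \<open>z\<close>, the difference is too small for
  the lower bound \<open>c\<close>.\<close>

lemma not_L2_convergent_if_disjoint_supports:
  assumes L2: "\<And>i. L2 (y i)" "L2 z" and c: "c > 0" "\<And>i. c \<le> (\<integral>x. (cmod (y i x))\<^sup>2 \<partial>Rplus)"
    and supp: "\<And>i x. x \<notin> S i \<Longrightarrow> y i x = 0" "disjoint_family S"
  shows "\<not> (\<lambda>i. L2_norm (\<lambda>x. y i x - z x)) \<longlonglongrightarrow> 0"
proof
  define e where "e = (\<lambda>i. \<integral>x. (cmod (y i x - z x))\<^sup>2 \<partial>Rplus)"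
  assume "(\<lambda>i. L2_norm (\<lambda>x. y i x - z x)) \<longlonglongrightarrow> 0"
  then have "e \<longlonglongrightarrow> 0\<^sup>2"
    unfolding e_def L2_norm_power2[symmetric] by (rule tendsto_power)
  \<comment> \<open>Two errors below \<open>c / 4\<close>, each doubled, add up to less than
    \<open>c\<close>.\<close>
  then have "\<forall>\<^sub>F i in sequentially. e i < c / 4"
    using c(1) by (intro order_tendstoD(2)) auto
  then obtain i where i: "e i < c / 4" "e (Suc i) < c / 4"
    unfolding eventually_sequentially by (meson le_SucI order_refl)
  have d: "L2 (\<lambda>x. y k x - z x)" for k
    using L2_add_scaled(1)[OF L2(1)[of k] L2(2), of "-1"] by simp
  note sub = L2_add_scaled[OF d[of i] d[of "Suc i"], of "-1"]
  have "c \<le> (\<integral>x. (cmod (y i x))\<^sup>2 \<partial>Rplus)" by (rule c(2))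
  also have "\<dots> \<le> (\<integral>x. (cmod (y i x - z x + - 1 * (y (Suc i) x - z x)))\<^sup>2 \<partial>Rplus)"
  proof (rule integral_mono)
    show "integrable Rplus (\<lambda>x. (cmod (y i x))\<^sup>2)" using L2(1) by (simp add: L2_def)
    show "integrable Rplus (\<lambda>x. (cmod (y i x - z x + - 1 * (y (Suc i) x - z x)))\<^sup>2)"
      using sub(1) by (simp add: L2_def)
    fix x
    have "y i x = 0 \<or> y (Suc i) x = 0"
    proof -
      have "S i \<inter> S (Suc i) = {}" using supp(2) by (simp add: disjoint_family_on_def)
      then show ?thesis using supp(1)[of x i] supp(1)[of x "Suc i"] by blast
    qed
    then show "(cmod (y i x))\<^sup>2 \<le> (cmod (y i x - z x + - 1 * (y (Suc i) x - z x)))\<^sup>2"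
      by auto
  qed
  also have "\<dots> \<le> 2 * e i + 2 * e (Suc i)" using sub(2) by (simp add: e_def)
  also have "\<dots> < c" using i by simp
  finally show False by simp
qed

section \<open>Bumps on infinitely many intervals against a compact resolvent\<close>

lemma L1_loc_absolutely_integrable:
  assumes "L1_loc q" "0 \<le> u"
  shows "q absolutely_integrable_on {u..v}"
proof (cases "u \<le> v")
  case True
  have "integrable (lebesgue_on {0..v}) q" using assms True by (simp add: L1_loc_def)
  then have "q absolutely_integrable_on {0..v}"
    by (simp add: set_integrable_def integrable_restrict_space)
  then show ?thesis by (rule set_integrable_subset) (use assms in auto)
qed (simp add: absolutely_integrable_on_def)

text \<open>Placing \<open>D k\<close> between an open interval and its closure admits open, closed
  and half-open intervals alike.\<close>

theorem theorem5:
  fixes n :: nat and C0 :: complex and p :: "nat \<Rightarrow> real \<Rightarrow> complex"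
  assumes "n \<ge> 2"
    and "p 1 = (\<lambda>_. C0)"
    and "\<forall>j\<in>{2..n}. L1_loc (p j)"
    and "\<exists>G. is_operator G \<and> L0_graph n p \<subseteq> G \<and> has_compact_resolvent G"
  shows "\<forall>(D :: nat \<Rightarrow> real set) (a :: nat \<Rightarrow> real) (h :: real).
           h > 0 \<and> (\<forall>k. {a k<..<a k + h} \<subseteq> D k \<and> D k \<subseteq> {a k..a k + h} \<and> D k \<subseteq> {0..})
           \<and> disjoint_family D
           \<longrightarrow> filterlim (\<lambda>k. \<integral>x. (\<Sum>j=2..n. cmod (p j x)) \<partial>(lebesgue_on (D k))) at_top sequentially"
proof (intro allI impI, rule ccontr)
  fix D :: "nat \<Rightarrow> real set" and a :: "nat \<Rightarrow> real" and h :: real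
  let ?g = "\<lambda>x. \<Sum>j=2..n. cmod (p j x)"
  let ?I = "\<lambda>k. \<integral>x. ?g x \<partial>(lebesgue_on (D k))"
  assume "h > 0 \<and> (\<forall>k. {a k<..<a k + h} \<subseteq> D k \<and> D k \<subseteq> {a k..a k + h} \<and> D k \<subseteq> {0..}) \<and> disjoint_family D"
  then have h: "h > 0" and D: "\<And>k. {a k<..<a k + h} \<subseteq> D k" "\<And>k. D k \<subseteq> {a k..a k + h}" "\<And>k. D k \<subseteq> {0..}"
    and disj: "disjoint_family D" by auto
  assume "\<not> filterlim ?I at_top sequentially"
  then obtain M0 where "\<not> (\<forall>\<^sub>F k in sequentially. M0 \<le> ?I k)"
    by (auto simp: filterlim_at_top)
  then have "infinite {k. ?I k < M0}"
    by (simp add: eventually_sequentially infinite_nat_iff_unbounded_le not_le)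
  then obtain s :: "nat \<Rightarrow> nat" where s: "strict_mono s" "\<And>i. ?I (s i) < M0"
    using infinite_enumerate[of "{k. ?I k < M0}"] by auto
  have a: "0 \<le> a k" for k
  proof (rule ccontr)
    assume "\<not> 0 \<le> a k"
    \<comment> \<open>The midpoint of the part of the open interval that lies below zero.\<close>
    then have "(a k + min 0 (a k + h)) / 2 \<in> {a k<..<a k + h}" "(a k + min 0 (a k + h)) / 2 < 0"
      using h by (auto simp: min_def)
    then show False using D(1,3)[of k] by (meson atLeast_iff not_less subsetD)
  qed
  define M where "M = max M0 0"
  define \<kappa> where "\<kappa> = 1 / (4 * real n * (real n + 1))"
  \<comment> \<open>The bound \<open>h\<close> keeps the short interval inside \<open>D k\<close> up
    to end points, 1 is the length limit in \<open>perturbation\<close>, and the quotient makes the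
    weight at most \<kappa>. None of them depends on \<open>k\<close>.\<close>
  define \<delta> where "\<delta> = min (min h 1) (\<kappa> / (cmod C0 + M + 1))"
  have pos: "cmod C0 + M + 1 > 0" by (simp add: M_def add_nonneg_pos)
  have \<kappa>_pos: "\<kappa> > 0" using assms(1) by (simp add: \<kappa>_def)
  have "1 * 1 \<le> real n * (real n + 1)" using assms(1) by (intro mult_mono) auto
  then have \<kappa>_half: "\<kappa> \<le> 1 / 2" by (simp add: \<kappa>_def divide_simps)
  have \<delta>: "\<delta> > 0" "\<delta> \<le> h" "\<delta> \<le> 1" "\<delta> * (cmod C0 + M) \<le> \<kappa>"
  proof -
    show "\<delta> > 0" "\<delta> \<le> h" "\<delta> \<le> 1" using h pos \<kappa>_pos by (auto simp: \<delta>_def)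
    have "\<delta> * (cmod C0 + M) \<le> \<delta> * (cmod C0 + M + 1)" using \<open>\<delta> > 0\<close> by (intro mult_left_mono) auto
    also have "\<dots> \<le> \<kappa>" using pos by (auto simp: \<delta>_def pos_le_divide_eq[symmetric])
    finally show "\<delta> * (cmod C0 + M) \<le> \<kappa>" .
  qed
  have p_ai: "p j absolutely_integrable_on {u..v}" if "j \<in> {1..n}" "0 \<le> u" for j u v
  proof (cases "j = 1")
    case True
    then show ?thesis using assms(2) by (simp add: absolutely_integrable_on_const)
  next
    case False
    then show ?thesis using that assms(3) by (intro L1_loc_absolutely_integrable) auto
  qed
  have g_ai: "?g absolutely_integrable_on {u..v}" if "0 \<le> u" for u v
    using that absolutely_integrable_norm[OF p_ai] by (intro absolutely_integrable_sum) (auto simp: o_def)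
  have pert: "perturbation n p (a k) (a k + \<delta>) \<kappa>" if k: "?I k < M0" for k
  proof
    show "n \<ge> 1" using assms(1) by simp
    show "a k < a k + \<delta>" "a k + \<delta> - a k \<le> 1" using \<delta> by auto
    show "p j absolutely_integrable_on {a k..a k + \<delta>}" if "j \<in> {1..n}" for j
      by (rule p_ai[OF that a])
    show "\<kappa> \<le> 1 / 2" by (rule \<kappa>_half)
    \<comment> \<open>\<open>D k\<close> differs from an open interval by at most two points, hence
      is measurable.\<close>
    have "D k = {a k<..<a k + h} \<union> (D k \<inter> {a k, a k + h})" using D(1,2)[of k] by force
    moreover have "D k \<inter> {a k, a k + h} \<in> sets lebesgue"
      by (intro sets.countable[of "D k \<inter> {a k, a k + h}" lebesgue]) auto
    ultimately have Dm: "D k \<in> sets lebesgue" by (metis lborelD open_greaterThanLessThan sets.Un borel_open sets_completionI_sets sets_lborel)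
    have gD: "?g absolutely_integrable_on D k"
      by (rule set_integrable_subset[OF g_ai[OF a, of k "a k + h"]]) (use Dm D(2)[of k] in auto)
    then have "integrable (lebesgue_on (D k)) ?g"
      using Dm by (simp add: set_integrable_def integrable_restrict_space)
    then have I: "?I k = integral (D k) ?g"
      by (rule lebesgue_integral_eq_integral[OF _ Dm])
    have "integral {a k..a k + \<delta>} ?g = integral {a k<..<a k + \<delta>} ?g"
      by (rule integral_open_interval_real)
    also have "\<dots> \<le> integral (D k) ?g"
    proof (rule integral_subset_le)
      show "{a k<..<a k + \<delta>} \<subseteq> D k" using D(1)[of k] \<delta>(2) by force
      show "?g integrable_on {a k<..<a k + \<delta>}"
        unfolding integrable_on_open_interval_real
        by (rule set_lebesgue_integral_eq_integral(1)[OF g_ai[OF a]])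
      show "?g integrable_on D k" by (rule set_lebesgue_integral_eq_integral(1)[OF gD])
    qed (auto intro: sum_nonneg)
    also have "\<dots> \<le> M" using k unfolding I M_def by simp
    finally have gM: "integral {a k..a k + \<delta>} ?g \<le> M" .
    have "integral {a k..a k + \<delta>} (\<lambda>t. cmod (p 1 t) + (a k + \<delta> - a k) * ?g t)
        = integral {a k..a k + \<delta>} (\<lambda>t. cmod C0) + integral {a k..a k + \<delta>} (\<lambda>t. \<delta> * ?g t)"
      unfolding assms(2) add_diff_cancel_left'
      by (rule Henstock_Kurzweil_Integration.integral_add)
         (use set_lebesgue_integral_eq_integral(1)[OF g_ai[OF a]] in \<open>auto intro!: integrable_on_mult_right\<close>)
    also have "\<dots> = \<delta> * (cmod C0 + integral {a k..a k + \<delta>} ?g)"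
      using \<delta>(1) by (simp add: algebra_simps)
    also have "\<dots> \<le> \<delta> * (cmod C0 + M)" using gM \<delta>(1) by (intro mult_left_mono) auto
    also note \<delta>(4)
    finally show "integral {a k..a k + \<delta>} (\<lambda>t. cmod (p 1 t) + (a k + \<delta> - a k) * ?g t) \<le> \<kappa>" .
  qed
  \<comment> \<open>The lower bound of \<open>bump_exists\<close> for length \<delta>; it is the
    same for every interval, as the final contradiction requires.\<close>
  define c where "c = ((\<delta> / (real n * (real n + 1))) ^ n / 2 ^ (n + 1)) ^ 3 / 16"
  have c: "c > 0" using \<delta>(1) assms(1) by (simp add: c_def)
  define good where "good i Y \<longleftrightarrow> deriv_family n Y \<and> (\<forall>k<n. Y k 0 = 0) \<and>
      (\<forall>x. x \<notin> {a (s i)<..<a (s i) + \<delta>} \<longrightarrow> Y 0 x = 0) \<and>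
      L2 (Y 0) \<and> (\<integral>x. (cmod (Y 0 x))\<^sup>2 \<partial>Rplus) \<le> 4 \<and> c \<le> (\<integral>x. (cmod (Y 0 x))\<^sup>2 \<partial>Rplus) \<and>
      L2 (diff_expr n p Y) \<and> (\<integral>x. (cmod (diff_expr n p Y x))\<^sup>2 \<partial>Rplus) \<le> 1" for i Y
  have "\<exists>Y. good i Y" for i
  proof -
    interpret perturbation n p "a (s i)" "a (s i) + \<delta>" \<kappa> by (rule pert[OF s(2)])
    have c_eq: "(step ^ n / 2 ^ (n + 1)) ^ 3 / 16 = c" by (simp add: c_def step_def)
    show ?thesis
      by (rule bump_exists[OF assms(1) a, unfolded c_eq]) (auto simp: \<kappa>_def good_def)
  qed
  then obtain Y where "\<And>i. good i (Y i)" by metis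
  then have Y: "\<And>i. deriv_family n (Y i)" "\<And>i k. k < n \<Longrightarrow> Y i k 0 = 0"
    "\<And>i x. x \<notin> {a (s i)<..<a (s i) + \<delta>} \<Longrightarrow> Y i 0 x = 0"
    "\<And>i. L2 (Y i 0)" "\<And>i. (\<integral>x. (cmod (Y i 0 x))\<^sup>2 \<partial>Rplus) \<le> 4"
    "\<And>i. c \<le> (\<integral>x. (cmod (Y i 0 x))\<^sup>2 \<partial>Rplus)"
    "\<And>i. L2 (diff_expr n p (Y i))" "\<And>i. (\<integral>x. (cmod (diff_expr n p (Y i) x))\<^sup>2 \<partial>Rplus) \<le> 1"
    unfolding good_def by blast+
  obtain G \<mu> where G: "L0_graph n p \<subseteq> G" and compact: "compact_resolvent_at G \<mu>"
    using assms(4) by (auto simp: has_compact_resolvent_def)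
  have in_G: "(Y i 0, diff_expr n p (Y i)) \<in> G" for i
  proof -
    have "\<exists>x0>0. \<forall>x\<ge>x0. Y i 0 x = 0"
      using a[of "s i"] \<delta>(1) Y(3)[of _ i] by (intro exI[of _ "a (s i) + \<delta>"]) auto
    then have "(Y i 0, diff_expr n p (Y i)) \<in> L0_graph n p"
      using Y(1,2,4,7) unfolding L0_graph_def by blast
    then show ?thesis using G by blast
  qed
  \<comment> \<open>With g = l(y) - \<mu> y, the bump y is the resolvent at \<mu> applied to
    g.\<close>
  define g where "g = (\<lambda>i x. diff_expr n p (Y i) x + - \<mu> * Y i 0 x)"
  \<comment> \<open>The squared norms of l(y) and y are at most 1 and 4, which gives 2 * 1 + 2
    |\<mu>|^2 * 4.\<close>
  define B where "B = sqrt (2 + 8 * (cmod \<mu>)\<^sup>2)"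
  have "L2 (g i) \<and> L2_norm (g i) \<le> B \<and> (Y i 0, \<lambda>x. g i x + \<mu> * Y i 0 x) \<in> G" for i
  proof (intro conjI)
    note sum = L2_add_scaled[OF Y(7)[of i] Y(4)[of i], of "- \<mu>"]
    show "L2 (g i)" unfolding g_def by (rule sum(1))
    have "(\<integral>x. (cmod (g i x))\<^sup>2 \<partial>Rplus) \<le> 2 * 1 + 2 * (cmod (- \<mu>))\<^sup>2 * 4"
      unfolding g_def
      by (rule order_trans[OF sum(2)], intro add_mono mult_left_mono Y) auto
    then show "L2_norm (g i) \<le> B" unfolding L2_norm_def B_def by simp
    have "(\<lambda>x. g i x + \<mu> * Y i 0 x) = diff_expr n p (Y i)" by (simp add: g_def)
    then show "(Y i 0, \<lambda>x. g i x + \<mu> * Y i 0 x) \<in> G" using in_G by simp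
  qed
  then obtain r z where r: "strict_mono r" "L2 z" "(\<lambda>i. L2_norm (\<lambda>x. Y (r i) 0 x - z x)) \<longlonglongrightarrow> 0"
    using compact[unfolded compact_resolvent_at_def, rule_format, of g B "\<lambda>i. Y i 0"] by auto
  have "disjoint_family (\<lambda>i. {a (s (r i))<..<a (s (r i)) + \<delta>})"
    unfolding disjoint_family_on_def
  proof (intro ballI impI)
    fix i j :: nat assume "i \<noteq> j"
    then have "s (r i) \<noteq> s (r j)" using s(1) r(1) by (simp add: strict_mono_eq)
    then have "D (s (r i)) \<inter> D (s (r j)) = {}" using disj by (simp add: disjoint_family_on_def)
    moreover have "{a k<..<a k + \<delta>} \<subseteq> D k" for k using D(1)[of k] \<delta>(2) by force
    ultimately show "{a (s (r i))<..<a (s (r i)) + \<delta>} \<inter> {a (s (r j))<..<a (s (r j)) + \<delta>} = {}" by blast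
  qed
  with Y(3,4,6) r(2) c have "\<not> (\<lambda>i. L2_norm (\<lambda>x. Y (r i) 0 x - z x)) \<longlonglongrightarrow> 0"
    by (intro not_L2_convergent_if_disjoint_supports
        [where S = "\<lambda>i. {a (s (r i))<..<a (s (r i)) + \<delta>}" and c = c])
  then show False using r(3) by blast
qed

end
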